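(* Let $n\ge 2$, $d\ge 2$ and $r\ge 1$ be integers, and let $V_n^d=\nu_d(\mathbb{P}^n)$ be the $d$-th Veronese variety. Then $$\mathcal{B}_r(V_n^d)\neq\emptyset \quad\text{if and only if}\quad 2r\ge d+1 .$$ Assume moreover that $\lceil (d+1)/2\rceil\le r\le d$ and let $A\in\mathcal{S}_r(\mathbb{P}^n)$ be such that $\nu_d(A)\in\mathcal{B}_r(V_n^d)$. Then: (1) If $r=d\ge 5$ and $d$ is odd, then either there is a line $L\subset\mathbb{P}^n$ containing at least $(d+1)/2$ points of $A$ and such that $B(\nu_d(A))=\nu_d(L\setminus A)$, or there are two distinct lines $L,R\subset\mathbb{P}^n$ intersecting in a unique point, which is a point of $A$, each containing $(d+1)/2$ points of $A$, and such that $B(\nu_d(A))=\nu_d((L\cup R)\setminus A)$. (2) If either $r<d$, or $r=d$ and $d$ is even, then there is a line $L\subset\mathbb{P}^n$ that contains at least $\lceil (d+1)/2\rceil$ points of $A$ and such that $B(\nu_d(A))=\nu_d(L\setminus A)$. (3) In the remaining case $r=d=3$, one has $\mathcal{B}_3(V_n^3)=\mathcal{S}_3(V_n^3)$. If $A\in\mathcal{S}_3(\mathbb{P}^n)$ is general (i.e. not contained in a line), then $B(\nu_d(A))\cup\nu_d(A)$ is the image under $\nu_d$ of the union of the three distinct lines each passing through two of the points of $A$. Otherwise $A\subset L$ for some line $L\subset\mathbb{P}^n$ and $B(\nu_d(A))=\nu_d(L\setminus A)$.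
   Context: The base field is $\mathbb{C}$. $\nu_d:\mathbb{P}^n\to\mathbb{P}^N$, $N=\binom{n+d}{d}-1$, is the Veronese embedding given by the complete linear system $|\mathcal{O}_{\mathbb{P}^n}(d)|$. For an integral nondegenerate variety $X\subset\mathbb{P}^N$, $X_{\mathrm{sm}}$ is its smooth locus and $\mathcal{S}_r(X)$ is the set of (unordered) sets of $r$ distinct smooth points of $X$. For a finite $A\subset X_{\mathrm{sm}}$, $2A$ is the zero-dimensional scheme with ideal sheaf $(\mathcal{I}_{A,X})^2$, and $\langle 2A\rangle\subseteq\mathbb{P}^N$ is its linear span, i.e. the span of the union of the tangent spaces $T_pX$, $p\in A$. The $r$-th base locus of $X$ is $$\mathcal{B}_r(X)=\{A\in\mathcal{S}_r(X)\mid \langle 2A\rangle\neq\mathbb{P}^N \text{ and } \langle 2A\rangle\cap(X_{\mathrm{sm}}\setminus A)\neq\emptyset\},$$ and for $A\in\mathcal{B}_r(X)$ one sets $B(A)=\langle 2A\rangle\cap(X_{\mathrm{sm}}\setminus A)$ (set-theoretic intersection). *)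

theory Defs
  imports "HOL-Analysis.Analysis"
begin

text \<open>
  Complex projective space: a point is a line through the origin of the space of homogeneous
  coordinates. The type \<open>'n proj\<close> has dimension \<open>CARD('n) - 1\<close>.
\<close>

typedef (overloaded) 'n proj = "{vec.span {v} | v :: complex ^ 'n::finite. v \<noteq> 0}"
proof -
  have "(axis undefined 1 :: complex ^ 'n) \<noteq> 0"
    by (simp add: axis_eq_0_iff)
  then show ?thesis by blast
qed

definition linear_locus :: "(complex ^ 'n::finite) set \<Rightarrow> 'n proj set" where
  "linear_locus W = {p. Rep_proj p \<subseteq> W}"

definition proj_span :: "'n::finite proj set \<Rightarrow> 'n proj set" where
  "proj_span S = linear_locus (vec.span (\<Union>p\<in>S. Rep_proj p))"

definition proj_line :: "'n::finite proj set \<Rightarrow> bool" where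
  "proj_line L \<longleftrightarrow> (\<exists>W. vec.subspace W \<and> vec.dim W = 2 \<and> L = linear_locus W)"

definition joining_lines :: "'n::finite proj set \<Rightarrow> 'n proj set set" where
  "joining_lines A = {L. proj_line L \<and> (\<exists>p\<in>A. \<exists>q\<in>A. p \<noteq> q \<and> p \<in> L \<and> q \<in> L)}"

definition exponents :: "nat \<Rightarrow> ('n::finite \<Rightarrow> nat) set" where
  "exponents k = {a. (\<Sum>i\<in>UNIV. a i) = k}"

definition monomial :: "('n::finite \<Rightarrow> nat) \<Rightarrow> complex ^ 'n \<Rightarrow> complex" where
  "monomial a z = (\<Prod>i\<in>UNIV. (z $ i) ^ a i)"

text \<open>
  Homogeneous polynomials are represented by the functions they define, which loses nothing
  because \<open>\<complex>\<close> is infinite.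
\<close>

definition forms :: "(complex ^ 'n::finite \<Rightarrow> complex) set" where
  "forms = {F. \<exists>k c. F = (\<lambda>z. \<Sum>a\<in>exponents k. c a * monomial a z)}"

definition vanishes_at :: "(complex ^ 'n::finite \<Rightarrow> complex) \<Rightarrow> 'n proj \<Rightarrow> bool" where
  "vanishes_at F p \<longleftrightarrow> (\<forall>v\<in>Rep_proj p. F v = 0)"

definition gradient :: "(complex ^ 'n::finite \<Rightarrow> complex) \<Rightarrow> complex ^ 'n \<Rightarrow> complex ^ 'n" where
  "gradient F v = (\<chi> j. deriv (\<lambda>t. F (v + t *s axis j 1)) 0)"

text \<open>
  The definitions below are meant for the point set \<open>X\<close> of a (reduced) closed subvariety.
  The homogeneous ideal is represented by its homogeneous elements.
\<close>

definition ideal_forms :: "'n::finite proj set \<Rightarrow> (complex ^ 'n \<Rightarrow> complex) set" where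
  "ideal_forms X = {F \<in> forms. \<forall>p\<in>X. vanishes_at F p}"

text \<open>The embedded projective tangent space.\<close>

definition tangent_space :: "'n::finite proj set \<Rightarrow> 'n proj \<Rightarrow> 'n proj set" where
  "tangent_space X p =
    {q. \<forall>F\<in>ideal_forms X. \<forall>v\<in>Rep_proj p - {0}. \<forall>w\<in>Rep_proj q.
          (\<Sum>j\<in>UNIV. gradient F v $ j * w $ j) = 0}"

text \<open>
  Smoothness is defined by the Jacobian condition: on a principal Zariski-open neighbourhood
  (where \<open>G\<close> does not vanish) of \<open>p\<close>, the variety is cut out by finitely many equations whose
  differentials at \<open>p\<close> are linearly independent.  Such equations define a smooth, hence reduced,
  scheme near \<open>p\<close>, so comparing zero sets suffices.
\<close>

definition smooth_locus :: "'n::finite proj set \<Rightarrow> 'n proj set" where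
  "smooth_locus X =
    {p \<in> X. \<exists>S G. finite S \<and> S \<subseteq> forms \<and> G \<in> forms \<and> \<not> vanishes_at G p \<and>
        (\<forall>q. \<not> vanishes_at G q \<longrightarrow> (q \<in> X \<longleftrightarrow> (\<forall>F\<in>S. vanishes_at F q))) \<and>
        (\<forall>v\<in>Rep_proj p - {0}.
           inj_on (\<lambda>F. gradient F v) S \<and> vec.independent ((\<lambda>F. gradient F v) ` S))}"

definition smooth_sets :: "nat \<Rightarrow> 'n::finite proj set \<Rightarrow> 'n proj set set" where
  "smooth_sets r X = {A. A \<subseteq> smooth_locus X \<and> finite A \<and> card A = r}"

text \<open>
  The linear span of the scheme \<open>2A\<close> of double points of \<open>X\<close> supported at \<open>A\<close>, i.e. the span of
  the tangent spaces of \<open>X\<close> at the points of \<open>A\<close>.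
\<close>

definition double_span :: "'n::finite proj set \<Rightarrow> 'n proj set \<Rightarrow> 'n proj set" where
  "double_span X A = proj_span (\<Union>p\<in>A. tangent_space X p)"

definition base_part :: "'n::finite proj set \<Rightarrow> 'n proj set \<Rightarrow> 'n proj set" where
  "base_part X A = double_span X A \<inter> (smooth_locus X - A)"

definition base_locus :: "nat \<Rightarrow> 'n::finite proj set \<Rightarrow> 'n proj set set" where
  "base_locus r X =
    {A \<in> smooth_sets r X. double_span X A \<noteq> UNIV \<and>
       base_part X A \<noteq> {}}"

text \<open>
  The Veronese map of degree \<open>d\<close> in coordinates.  The homogeneous coordinates of the target are
  indexed by a finite type \<open>'m\<close>, and \<open>e\<close> enumerates the exponents of the monomials of degree \<open>d\<close>
  without repetition, i.e. \<open>bij_betw e UNIV (exponents d)\<close>; hence the target has dimension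
  \<open>(n + d choose d) - 1\<close> when the source has dimension \<open>n\<close>.
\<close>

definition veronese_vec :: "('m::finite \<Rightarrow> 'n::finite \<Rightarrow> nat) \<Rightarrow> complex ^ 'n \<Rightarrow> complex ^ 'm" where
  "veronese_vec e v = (\<chi> j. monomial (e j) v)"

definition veronese :: "('m::finite \<Rightarrow> 'n::finite \<Rightarrow> nat) \<Rightarrow> 'n proj \<Rightarrow> 'm proj" where
  "veronese e p = Abs_proj (vec.span (veronese_vec e ` Rep_proj p))"

definition veronese_variety :: "('m::finite \<Rightarrow> 'n::finite \<Rightarrow> nat) \<Rightarrow> 'm proj set" where
  "veronese_variety e = range (veronese e)"

lemma monomial_scale:
  assumes "a \<in> exponents d"
  shows "monomial a (c *s v) = c ^ d * monomial a v"
  using assms unfolding exponents_def monomial_def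
  by (auto simp: power_mult_distrib prod.distrib power_sum)

text \<open>The map is well defined: \<open>[v] \<mapsto> [veronese_vec e v]\<close>.\<close>

lemma Rep_proj_veronese:
  assumes e: "bij_betw e UNIV (exponents d)" and v: "v \<noteq> 0" and p: "Rep_proj p = vec.span {v}"
  shows "veronese_vec e v \<noteq> 0" and "Rep_proj (veronese e p) = vec.span {veronese_vec e v}"
proof -
  have scale: "veronese_vec e (c *s v) = c ^ d *s veronese_vec e v" for c
  proof -
    have "e j \<in> exponents d" for j using e by (auto simp: bij_betw_def)
    then show ?thesis by (simp add: veronese_vec_def vec_eq_iff monomial_scale)
  qed
  obtain i where i: "v $ i \<noteq> 0" using v by (auto simp: vec_eq_iff)
  have "(\<lambda>k. if k = i then d else 0) \<in> exponents d" by (simp add: exponents_def)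
  then obtain j where j: "e j = (\<lambda>k. if k = i then d else 0)"
    using e unfolding bij_betw_def by (metis imageE)
  have "(v $ k) ^ (if k = i then d else 0) \<noteq> 0" for k using i by auto
  then have "veronese_vec e v $ j \<noteq> 0"
    by (simp add: veronese_vec_def monomial_def j)
  then show nz: "veronese_vec e v \<noteq> 0" by auto
  have "vec.span (veronese_vec e ` Rep_proj p) = vec.span {veronese_vec e v}"
  proof (rule vec.span_eq[THEN iffD2], intro conjI)
    show "veronese_vec e ` Rep_proj p \<subseteq> vec.span {veronese_vec e v}"
      using scale by (auto simp: p vec.span_singleton)
    have "veronese_vec e v \<in> veronese_vec e ` Rep_proj p"
      unfolding p by (simp add: vec.span_base)
    then show "{veronese_vec e v} \<subseteq> vec.span (veronese_vec e ` Rep_proj p)"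
      by (simp add: vec.span_base)
  qed
  then show "Rep_proj (veronese e p) = vec.span {veronese_vec e v}"
    unfolding veronese_def using nz by (auto intro!: Abs_proj_inverse)
qed

end

(* Linear functionals on the target of the Veronese map are the forms of degree d on the source, and
   such a functional kills the tangent space at nu_d(p) iff the form is singular at p.  So nu_d(q) lies
   in the span of the tangent spaces at nu_d(A) iff every form of degree d singular along A vanishes
   at q.  A form singular at (d+1)/2 or more points of a line restricts to it with more than d roots,
   hence vanishes on it.  Conversely, if |A| <= d and no line through q contains that many points of A,
   a product of d linear forms is singular along A and nonzero at q.  Hence, for |A| <= d, the base part is the union
   of the lines containing at least (d+1)/2 points of A, minus A, and the rest is a count of
   such lines. *)

theory Submission
  imports Defs
begin

subsection \<open>Derivatives of forms\<close>

text \<open>The bound |A| <= d is what the product construction can afford: a product is singular at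
  a point once two factors vanish there, and d factors through two points each provide 2d
  incidences, two for each of d points. The difficulty is to choose the pairs so that none of them
  spans a line through q; lines through q with fewer than (d+1)/2 points are exactly what a cyclic
  arrangement can handle. The count of lines is tight. Two lines with at least (d+1)/2 points of A
  share at most one of them, so together they use at least d points; hence a second line forces |A|
  = d, d odd, and equality everywhere. A third line then contains at most two points of A, fewer
  than (d+1)/2 as soon as d >= 5. For d = 3 two points suffice, so all sides of a triangle count.
  Smooth loci and tangent spaces are defined through equations, so the dictionary needs equations of
  the Veronese variety. Local ones on the charts of the source are enough, because they can be
  solved for the non-chart coordinates.\<close>

definition cdot :: "complex ^ 'n::finite \<Rightarrow> complex ^ 'n \<Rightarrow> complex" where
  "cdot c w = (\<Sum>j\<in>UNIV. c $ j * w $ j)"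

lemma cdot_zero [simp]: "cdot 0 w = 0" "cdot c 0 = 0"
  by (simp_all add: cdot_def)

lemma cdot_axis [simp]: "cdot c (axis j a) = c $ j * a" "cdot (axis j a) w = a * w $ j"
  by (simp_all add: cdot_def axis_def if_distrib [where f = "\<lambda>x. _ * x"]
      if_distrib [where f = "\<lambda>x. x * _"] cong: if_cong)

lemma cdot_add: "cdot c (v + w) = cdot c v + cdot c w" "cdot (c + c') w = cdot c w + cdot c' w"
  by (simp_all add: cdot_def algebra_simps sum.distrib)

lemma cdot_diff: "cdot c (v - w) = cdot c v - cdot c w"
  by (simp add: cdot_def algebra_simps sum_subtractf)

lemma cdot_scale: "cdot c (t *s w) = t * cdot c w" "cdot (t *s c) w = t * cdot c w"
  by (simp_all add: cdot_def sum_distrib_left mult_ac)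

lemma has_derivative_vec:
  fixes f :: "'a::real_normed_vector \<Rightarrow> complex ^ 'm::finite"
  assumes "\<And>i. ((\<lambda>x. f x $ i) has_derivative (\<lambda>x. f' x $ i)) (at a)"
  shows "(f has_derivative f') (at a)"
proof -
  have "((\<lambda>x. f x \<bullet> b) has_derivative (\<lambda>x. f' x \<bullet> b)) (at a)" if "b \<in> Basis" for b
  proof -
    obtain i u where b: "b = axis i u" using \<open>b \<in> Basis\<close> unfolding Basis_vec_def by blast
    show ?thesis unfolding b inner_axis
      by (intro has_derivative_inner_left assms)
  qed
  then show ?thesis using has_derivative_componentwise_within by blast
qed

lemma has_derivative_line:
  fixes v u :: "complex ^ 'n::finite"
  shows "((\<lambda>t. v + t *s u) has_derivative (\<lambda>t. t *s u)) (at s)"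
  by (rule has_derivative_vec) (auto intro!: derivative_eq_intros)

text \<open>\<open>has_derivative\<close> asks only for a real linear derivative. Demanding that it
  be a pairing \<open>cdot g\<close>, which is bilinear and involves no conjugation, makes it
  complex linear.\<close>

definition has_gradient ::
  "(complex ^ 'n::finite \<Rightarrow> complex) \<Rightarrow> complex ^ 'n \<Rightarrow> complex ^ 'n \<Rightarrow> bool" where
  "has_gradient F g v \<longleftrightarrow> (F has_derivative cdot g) (at v)"

lemma has_gradient_along:
  assumes "has_gradient F g (v + s *s u)"
  shows "((\<lambda>t. F (v + t *s u)) has_field_derivative cdot g u) (at s)"
proof -
  have "((\<lambda>t. F (v + t *s u)) has_derivative (\<lambda>t. cdot g (t *s u))) (at s)"
    using has_derivative_compose [OF has_derivative_line] assms
    unfolding has_gradient_def by blast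
  moreover have "(\<lambda>t. cdot g (t *s u)) = (*) (cdot g u)"
    by (simp add: fun_eq_iff cdot_scale mult.commute)
  ultimately show ?thesis
    by (simp add: has_field_derivative_def)
qed

lemma gradient_eqI:
  assumes "has_gradient F g v"
  shows "gradient F v = g"
proof -
  have "deriv (\<lambda>t. F (v + t *s axis j 1)) 0 = g $ j" for j
    using has_gradient_along [of F g v 0 "axis j 1"] assms by (simp add: DERIV_imp_deriv)
  then show ?thesis by (simp add: gradient_def vec_eq_iff)
qed

lemma has_gradient_const: "has_gradient (\<lambda>_. a) 0 v"
proof -
  have "cdot 0 = (\<lambda>_::complex^'a. 0)" by (simp add: fun_eq_iff)
  then show ?thesis unfolding has_gradient_def by simp
qed

lemma has_gradient_cdot: "has_gradient (cdot c) c v"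
  unfolding has_gradient_def cdot_def
  by (rule bounded_linear_imp_has_derivative) (intro bounded_linear_intros bounded_linear_vec_nth)

lemma has_gradient_coord: "has_gradient (\<lambda>z. z $ i) (axis i 1) v"
proof -
  have "cdot (axis i 1) = (\<lambda>z. z $ i)" by (simp add: fun_eq_iff)
  then show ?thesis using has_gradient_cdot [of "axis i 1" v] by simp
qed

lemma has_gradient_add:
  assumes "has_gradient F f v" and "has_gradient G g v"
  shows "has_gradient (\<lambda>z. F z + G z) (f + g) v"
proof -
  have "cdot (f + g) = (\<lambda>w. cdot f w + cdot g w)" by (simp add: fun_eq_iff cdot_add)
  then show ?thesis using assms unfolding has_gradient_def by (simp add: has_derivative_add)
qed

lemma has_gradient_mult:
  assumes "has_gradient F f v" and "has_gradient G g v"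
  shows "has_gradient (\<lambda>z. F z * G z) (F v *s g + G v *s f) v"
proof -
  have "cdot (F v *s g + G v *s f) = (\<lambda>w. F v * cdot g w + cdot f w * G v)"
    by (simp add: fun_eq_iff cdot_add cdot_scale)
  then show ?thesis using assms unfolding has_gradient_def by (simp add: has_derivative_mult)
qed

section \<open>Forms of a fixed degree: closure properties, homogeneity, restriction to
  lines\<close>

definition hforms :: "nat \<Rightarrow> (complex ^ 'n::finite \<Rightarrow> complex) set" where
  "hforms k = {F. \<exists>c. F = (\<lambda>z. \<Sum>a\<in>exponents k. c a * monomial a z)}"

lemma forms_eq_Union_hforms: "forms = (\<Union>k. hforms k)"
  by (auto simp: forms_def hforms_def)

lemma finite_exponents: "finite (exponents k :: ('n::finite \<Rightarrow> nat) set)"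
proof (rule finite_subset)
  show "(exponents k :: ('n \<Rightarrow> nat) set) \<subseteq> Pi\<^sub>E UNIV (\<lambda>_. {..k})"
  proof
    fix a :: "'n \<Rightarrow> nat" assume "a \<in> exponents k"
    then have "a i \<le> k" for i
      unfolding exponents_def using member_le_sum [of i UNIV a] by auto
    then show "a \<in> Pi\<^sub>E UNIV (\<lambda>_. {..k})" by auto
  qed
qed (simp add: finite_PiE)

lemma hforms_monomial:
  assumes "a \<in> exponents k"
  shows "monomial a \<in> hforms k"
proof -
  have "monomial a = (\<lambda>z. \<Sum>b\<in>exponents k. (if b = a then 1 else 0) * monomial b z)"
    using assms
    by (intro ext) (simp add: finite_exponents if_distrib [where f = "\<lambda>x. x * _"] cong: if_cong)
  then show ?thesis unfolding hforms_def
    by (intro CollectI exI [of _ "\<lambda>b. if b = a then 1 else 0"])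
qed

lemma hforms_add:
  assumes "F \<in> hforms k" and "G \<in> hforms k"
  shows "(\<lambda>z. F z + G z) \<in> hforms k"
proof -
  obtain b c where "F = (\<lambda>z. \<Sum>a\<in>exponents k. b a * monomial a z)"
    "G = (\<lambda>z. \<Sum>a\<in>exponents k. c a * monomial a z)" using assms by (auto simp: hforms_def)
  then have "(\<lambda>z. F z + G z) = (\<lambda>z. \<Sum>a\<in>exponents k. (b a + c a) * monomial a z)"
    by (simp add: fun_eq_iff sum.distrib algebra_simps)
  then show ?thesis unfolding hforms_def by (intro CollectI exI [of _ "\<lambda>a. b a + c a"])
qed

lemma hforms_scale:
  assumes "F \<in> hforms k"
  shows "(\<lambda>z. t * F z) \<in> hforms k"
proof -
  obtain b where "F = (\<lambda>z. \<Sum>a\<in>exponents k. b a * monomial a z)"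
    using assms by (auto simp: hforms_def)
  then have "(\<lambda>z. t * F z) = (\<lambda>z. \<Sum>a\<in>exponents k. (t * b a) * monomial a z)"
    by (simp add: fun_eq_iff sum_distrib_left algebra_simps)
  then show ?thesis unfolding hforms_def by (intro CollectI exI [of _ "\<lambda>a. t * b a"])
qed

lemma hforms_zero: "(\<lambda>z. 0) \<in> hforms k"
  unfolding hforms_def by (intro CollectI exI [of _ "\<lambda>a. 0"]) simp

lemma hforms_sum:
  assumes "\<And>i. i \<in> I \<Longrightarrow> F i \<in> hforms k"
  shows "(\<lambda>z. \<Sum>i\<in>I. F i z) \<in> hforms k"
  using assms
proof (induction I rule: infinite_finite_induct)
  case (insert i I)
  then show ?case using hforms_add [of "F i" k "\<lambda>z. \<Sum>i\<in>I. F i z"] by simp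
qed (simp_all add: hforms_zero)

lemma monomial_mult: "monomial a z * monomial b z = monomial (\<lambda>i. a i + b i) z"
  by (simp add: monomial_def power_add prod.distrib)

lemma hforms_mult:
  assumes "F \<in> hforms k" and "G \<in> hforms l"
  shows "(\<lambda>z. F z * G z) \<in> hforms (k + l)"
proof -
  obtain b c where F: "F = (\<lambda>z. \<Sum>a\<in>exponents k. b a * monomial a z)"
    and G: "G = (\<lambda>z. \<Sum>a\<in>exponents l. c a * monomial a z)" using assms by (auto simp: hforms_def)
  have "(\<lambda>z. F z * G z) =
      (\<lambda>z. \<Sum>a\<in>exponents k. \<Sum>a'\<in>exponents l. (b a * c a') * monomial (\<lambda>i. a i + a' i) z)"
    by (simp add: F G fun_eq_iff sum_product monomial_mult [symmetric] mult_ac)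
  moreover have "\<dots> \<in> hforms (k + l)"
    by (intro hforms_sum hforms_scale hforms_monomial) (auto simp: exponents_def sum.distrib)
  ultimately show ?thesis by simp
qed

lemma hforms_coord: "(\<lambda>z. z $ i) \<in> hforms 1"
proof -
  have "(\<lambda>z. z $ i) = monomial (\<lambda>j. if j = i then 1 else 0)"
    by (simp add: fun_eq_iff monomial_def if_distrib [where f = "\<lambda>x. _ ^ x"] cong: if_cong)
  then show ?thesis by (simp add: hforms_monomial exponents_def)
qed

lemma hforms_const: "(\<lambda>z. c) \<in> hforms 0"
proof -
  have "(\<lambda>z::complex^'a. 1) = monomial (\<lambda>j. 0)" by (simp add: fun_eq_iff monomial_def)
  then have "(\<lambda>z::complex^'a. 1) \<in> hforms 0" by (simp add: hforms_monomial exponents_def)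
  then show ?thesis using hforms_scale [of "\<lambda>z. 1" 0 c] by simp
qed

lemma hforms_cdot: "cdot c \<in> hforms 1"
proof -
  have "cdot c = (\<lambda>z. \<Sum>i\<in>UNIV. c $ i * z $ i)" by (simp add: fun_eq_iff cdot_def)
  then show ?thesis by (simp add: hforms_sum hforms_scale hforms_coord del: One_nat_def)
qed

lemma hforms_prod:
  assumes "finite I" and "\<And>i. i \<in> I \<Longrightarrow> F i \<in> hforms (k i)"
  shows "(\<lambda>z. \<Prod>i\<in>I. F i z) \<in> hforms (\<Sum>i\<in>I. k i)"
  using assms
proof (induction I rule: finite_induct)
  case empty
  then show ?case by (simp add: hforms_const)
next
  case (insert i I)
  then show ?case using hforms_mult [of "F i" "k i" "\<lambda>z. \<Prod>i\<in>I. F i z" "\<Sum>i\<in>I. k i"] by simp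
qed

lemma hforms_power:
  assumes "F \<in> hforms k"
  shows "(\<lambda>z. F z ^ n) \<in> hforms (n * k)"
  using hforms_prod [of "{..<n}" "\<lambda>_. F" "\<lambda>_. k"] assms by simp

text \<open>Lets differentiability, homogeneity and polynomiality along lines be checked on
  constants and coordinates, with the bookkeeping of degrees done once.\<close>

lemma hforms_induct [consumes 1, case_names const coord add mult]:
  fixes F :: "complex ^ 'n::finite \<Rightarrow> complex"
  assumes "F \<in> hforms k"
    and const: "\<And>c. P (\<lambda>_. c) 0"
    and coord: "\<And>i. P (\<lambda>z. z $ i) 1"
    and add: "\<And>F G k. P F k \<Longrightarrow> P G k \<Longrightarrow> P (\<lambda>z. F z + G z) k"
    and mult: "\<And>F G k l. P F k \<Longrightarrow> P G l \<Longrightarrow> P (\<lambda>z. F z * G z) (k + l)"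
  shows "P F k"
proof -
  have scale: "P (\<lambda>z. c * F z) k" if "P F k" for c F k
    using mult [OF const [of c] that] by simp
  have pow: "P (\<lambda>z. z $ i ^ n) n" for i n
  proof (induction n)
    case 0
    then show ?case using const [of 1] by simp
  next
    case (Suc n)
    then show ?case using mult [OF coord [of i] Suc] by simp
  qed
  have mon: "P (\<lambda>z. \<Prod>i\<in>I. z $ i ^ a i) (\<Sum>i\<in>I. a i)" for a :: "'n \<Rightarrow> nat" and I
  proof -
    have "finite I" by simp
    then show ?thesis
    proof (induction I rule: finite_induct)
      case empty
      then show ?case using const [of 1] by simp
    next
      case (insert i I)
      then show ?case using mult [OF pow [of i "a i"] insert.IH] by simp
    qed
  qed
  have mon': "P (monomial a) k" if "a \<in> exponents k" for a :: "'n \<Rightarrow> nat"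
  proof -
    have "monomial a = (\<lambda>z. \<Prod>i\<in>UNIV. z $ i ^ a i)" by (simp add: fun_eq_iff monomial_def)
    then show ?thesis using mon [of a UNIV] that by (simp add: exponents_def)
  qed
  \<comment> \<open>A nonempty index set lets the sum start from a first summand, so the induction
    needs no separate case for the zero form of degree \<open>k\<close>.\<close>
  have ne: "exponents k \<noteq> ({} :: ('n \<Rightarrow> nat) set)"
  proof -
    have "(\<lambda>i::'n. if i = undefined then k else 0) \<in> exponents k" by (simp add: exponents_def)
    then show ?thesis by blast
  qed
  obtain c where F: "F = (\<lambda>z. \<Sum>a\<in>exponents k. c a * monomial a z)"
    using assms(1) by (auto simp: hforms_def)
  have "P (\<lambda>z. \<Sum>a\<in>I. c a * monomial a z) k" if "finite I" "I \<noteq> {}" "I \<subseteq> exponents k" for I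
    using that
  proof (induction I rule: finite_ne_induct)
    case (singleton a)
    then show ?case by (simp add: scale mon')
  next
    case (insert a I)
    have "P (\<lambda>z. c a * monomial a z) k" using insert.prems by (simp add: scale mon')
    from add [OF this insert.IH] show ?case using insert.hyps insert.prems by simp
  qed
  from this [OF finite_exponents ne order_refl] show ?thesis by (simp add: F)
qed

text \<open>\<open>gradient\<close> is built from the total operator \<open>deriv\<close>; this
  guarantees that for forms its entries are genuine derivatives.\<close>

lemma hforms_has_gradient:
  assumes "F \<in> hforms k"
  shows "has_gradient F (gradient F v) v"
proof -
  have "\<exists>g. has_gradient F g v"
    using assms
    by (induction rule: hforms_induct)
      (blast intro: has_gradient_const has_gradient_coord has_gradient_add has_gradient_mult)+
  then show ?thesis using gradient_eqI by metis
qed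

lemma hforms_homogeneous:
  assumes "F \<in> hforms k"
  shows "F (t *s v) = t ^ k * F v"
  using assms by (induction rule: hforms_induct) (simp_all add: algebra_simps power_add)

text \<open>Turns a form on a line into a univariate polynomial, so that roots can be counted with
  multiplicity.\<close>

lemma hforms_along_line:
  assumes "F \<in> hforms k"
  shows "\<exists>P. degree P \<le> k \<and> (\<forall>s. poly P s = F (q + s *s u))"
  using assms
proof (induction rule: hforms_induct)
  case (const c)
  then show ?case by (intro exI [of _ "[:c:]"]) simp
next
  case (coord i)
  then show ?case by (intro exI [of _ "[:q $ i, u $ i:]"]) (simp add: degree_pCons_le)
next
  case (add F G k)
  then obtain P Q where "degree P \<le> k" "degree Q \<le> k"
    "\<forall>s. poly P s = F (q + s *s u)" "\<forall>s. poly Q s = G (q + s *s u)" by blast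
  then show ?case by (intro exI [of _ "P + Q"]) (simp add: degree_add_le)
next
  case (mult F G k l)
  then obtain P Q where "degree P \<le> k" "degree Q \<le> l"
    "\<forall>s. poly P s = F (q + s *s u)" "\<forall>s. poly Q s = G (q + s *s u)" by blast
  then show ?case
    by (intro exI [of _ "P * Q"]) (auto intro: order_trans [OF degree_mult_le])
qed

text \<open>Euler's relation, from differentiating F((1 + t) v) = (1 + t)^k F(v) at t = 0. For
  positive degree it shows that a form vanishes wherever its gradient does.\<close>

lemma hforms_euler:
  assumes "F \<in> hforms k"
  shows "cdot (gradient F v) v = of_nat k * F v"
proof -
  have "((\<lambda>t. F (v + t *s v)) has_field_derivative cdot (gradient F v) v) (at 0)"
    using has_gradient_along [of F _ v 0 v] hforms_has_gradient [OF assms] by simp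
  moreover have "(\<lambda>t. F (v + t *s v)) = (\<lambda>t. (1 + t) ^ k * F v)"
  proof
    fix t
    have "v + t *s v = (1 + t) *s v" by (simp add: vec.scale_left_distrib)
    then show "F (v + t *s v) = (1 + t) ^ k * F v" by (simp only: hforms_homogeneous [OF assms])
  qed
  moreover have "((\<lambda>t. (1 + t) ^ k * F v) has_field_derivative of_nat k * F v) (at 0)"
    by (auto intro!: derivative_eq_intros)
  ultimately show ?thesis using DERIV_unique by metis
qed

text \<open>A common root of P and its derivative has order at least two, and the orders of the
  roots of a nonzero polynomial add up to at most its degree.\<close>

lemma double_roots_imp_zero:
  fixes P :: "complex poly"
  assumes "finite S" and "degree P < 2 * card S"
    and "\<And>s. s \<in> S \<Longrightarrow> poly P s = 0 \<and> poly (pderiv P) s = 0"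
  shows "P = 0"
proof (rule ccontr)
  assume nz: "P \<noteq> 0"
  have two: "2 \<le> order s P" if "s \<in> S" for s
  proof -
    \<comment> \<open>Otherwise P would be constant, and a constant with a root is zero. Only for a
      nonzero derivative does its order at \<open>s\<close> reflect that \<open>s\<close> is a
      root.\<close>
    have "pderiv P \<noteq> 0"
    proof
      assume "pderiv P = 0"
      then obtain c where "P = [:c:]" using pderiv_eq_0_iff degree_eq_zeroE by metis
      then show False using assms(3) [OF that] nz by simp
    qed
    then have "order s (pderiv P) \<noteq> 0"
      using assms(3) [OF that] by (simp add: order_root)
    moreover have "order s P = Suc (order s (pderiv P))"
      using assms(3) [OF that] by (intro order_pderiv nz) simp
    ultimately show ?thesis by linarith
  qed
  have "2 * card S = (\<Sum>s\<in>S. 2)" by simp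
  also have "\<dots> \<le> (\<Sum>s\<in>S. count (proots P) s)"
    using two nz by (intro sum_mono) simp
  also have "\<dots> \<le> size (proots P)"
  proof -
    have "S \<subseteq> set_mset (proots P)" using assms(3) nz by auto
    then show ?thesis unfolding size_multiset_overloaded_eq by (intro sum_mono2) auto
  qed
  also have "\<dots> \<le> degree P" by (rule size_proots_le)
  finally show False using assms(2) by simp
qed

subsection \<open>Points and linear subspaces\<close>

text \<open>An arbitrary representative. Vanishing and singularity of a form are invariant under
  scaling (\<open>vanishes_at_iff\<close>, \<open>gradient_scale_eq_0_iff\<close>), so they may be
  tested on it.\<close>

definition hvec :: "'n::finite proj \<Rightarrow> complex ^ 'n" where
  "hvec p = (SOME v. v \<noteq> 0 \<and> Rep_proj p = vec.span {v})"

lemma hvec: "hvec p \<noteq> 0" "Rep_proj p = vec.span {hvec p}"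
proof -
  have "\<exists>v. v \<noteq> 0 \<and> Rep_proj p = vec.span {v}" using Rep_proj [of p] by blast
  from someI_ex [OF this] show "hvec p \<noteq> 0" "Rep_proj p = vec.span {hvec p}"
    unfolding hvec_def by blast+
qed

lemma hvec_in_Rep: "hvec p \<in> Rep_proj p"
  by (simp add: hvec(2) vec.span_base)

lemma span_singleton_eq:
  fixes v w :: "'a::field ^ 'n"
  assumes "w \<in> vec.span {v}" and "w \<noteq> 0"
  shows "vec.span {w} = vec.span {v}"
proof -
  obtain c where c: "w = c *s v" using assms(1) by (auto simp: vec.span_singleton)
  with assms(2) have "c \<noteq> 0" by auto
  then have "v = inverse c *s w" using c by simp
  then have "v \<in> vec.span {w}" by (metis insertI1 vec.span_base vec.span_scale)
  then show ?thesis using assms(1) by (simp add: vec.span_eq)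
qed

lemma Rep_proj_eq_span:
  assumes "w \<in> Rep_proj p" and "w \<noteq> 0"
  shows "Rep_proj p = vec.span {w}"
  using span_singleton_eq [of w "hvec p"] assms by (simp add: hvec(2))

lemma proj_eqI:
  assumes "w \<in> Rep_proj p" and "w \<in> Rep_proj q" and "w \<noteq> 0"
  shows "p = q"
  using assms by (metis Rep_proj_eq_span Rep_proj_inject)

lemma ex_proj:
  assumes "v \<noteq> 0"
  obtains p where "Rep_proj p = vec.span {v}"
proof
  show "Rep_proj (Abs_proj (vec.span {v})) = vec.span {v}"
    using assms by (intro Abs_proj_inverse) auto
qed

lemma in_linear_locus_iff:
  assumes "vec.subspace W"
  shows "p \<in> linear_locus W \<longleftrightarrow> hvec p \<in> W"
proof -
  have "vec.span {hvec p} \<subseteq> W \<longleftrightarrow> hvec p \<in> W"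
    using assms vec.span_minimal [of "{hvec p}" W] vec.span_base [of "hvec p" "{hvec p}"] by auto
  then show ?thesis by (simp add: linear_locus_def hvec(2))
qed

text \<open>Passing from subspaces to points and back loses nothing: a nonzero vector spans a point
  of the locus, and the zero vector, which represents no point, lies in every span.\<close>

lemma span_Union_Rep_linear_locus:
  assumes "\<And>i. i \<in> I \<Longrightarrow> vec.subspace (W i)"
  shows "vec.span (\<Union>p\<in>(\<Union>i\<in>I. linear_locus (W i)). Rep_proj p) = vec.span (\<Union>i\<in>I. W i)"
proof (rule vec.span_eq [THEN iffD2], intro conjI)
  show "(\<Union>p\<in>(\<Union>i\<in>I. linear_locus (W i)). Rep_proj p) \<subseteq> vec.span (\<Union>i\<in>I. W i)"
    unfolding linear_locus_def using vec.span_superset by fastforce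
  show "(\<Union>i\<in>I. W i) \<subseteq> vec.span (\<Union>p\<in>(\<Union>i\<in>I. linear_locus (W i)). Rep_proj p)"
  proof
    fix w assume "w \<in> (\<Union>i\<in>I. W i)"
    then obtain i where i: "i \<in> I" "w \<in> W i" by blast
    show "w \<in> vec.span (\<Union>p\<in>(\<Union>i\<in>I. linear_locus (W i)). Rep_proj p)"
    proof (cases "w = 0")
      case True
      then show ?thesis by (simp add: vec.span_zero)
    next
      case False
      then obtain p where p: "Rep_proj p = vec.span {w}" by (rule ex_proj)
      then have "p \<in> linear_locus (W i)"
        using assms [OF i(1)] i(2) by (simp add: linear_locus_def vec.span_minimal)
      moreover have "w \<in> Rep_proj p" by (simp add: p vec.span_base)
      ultimately show ?thesis using i(1) by (intro vec.span_base) blast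
    qed
  qed
qed

lemma separating_functional:
  fixes x :: "complex ^ 'n::finite"
  assumes "x \<notin> vec.span S"
  obtains c where "\<And>w. w \<in> vec.span S \<Longrightarrow> cdot c w = 0" and "cdot c x \<noteq> 0"
proof -
  obtain B where B: "B \<subseteq> S" "vec.independent B" "S \<subseteq> vec.span B"
    using vec.maximal_independent_subset by blast
  then have sp: "vec.span B = vec.span S"
    by (metis vec.span_eq vec.span_superset order_trans)
  then have "vec.independent (insert x B)"
    using assms B(2) by (simp add: vec.independent_insert)
  \<comment> \<open>The functional is taken as one coordinate, at the arbitrary index
    \<open>undefined\<close>, of a linear endomorphism that kills \<open>B\<close> and not
    \<open>x\<close>.\<close>
  from vec.linear_independent_extend
    [OF this, of "\<lambda>y. if y = x then axis undefined 1 else 0 :: complex ^ 'n"]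
  obtain f :: "complex ^ 'n \<Rightarrow> complex ^ 'n" where lin: "Vector_Spaces.linear (*s) (*s) f"
    and f: "\<forall>y\<in>insert x B. f y = (if y = x then axis undefined 1 else 0)"
    by blast
  define c :: "complex ^ 'n" where "c = (\<chi> j. f (axis j 1) $ undefined)"
  have c: "cdot c w = f w $ undefined" for w
    using matrix_works [OF lin, of w]
    by (simp add: cdot_def c_def matrix_vector_mult_def vec_eq_iff matrix_def)
  show ?thesis
  proof
    show "cdot c x \<noteq> 0" using f by (simp add: c)
    fix w assume "w \<in> vec.span S"
    then have "w \<in> vec.span B" by (simp add: sp)
    moreover have "f b = 0" if "b \<in> B" for b
    proof -
      have "x \<noteq> b" using assms that B(1) vec.span_base by blast
      then show ?thesis using f that by simp
    qed
    ultimately have "f w = 0"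
      using vec.linear_eq_0_on_span [OF lin] by blast
    then show "cdot c w = 0" by (simp add: c)
  qed
qed

lemma vanishes_at_iff:
  assumes "F \<in> hforms k" and "z \<in> Rep_proj p" and "z \<noteq> 0"
  shows "vanishes_at F p \<longleftrightarrow> F z = 0"
  using assms Rep_proj_eq_span [OF assms(2,3)]
  by (auto simp: vanishes_at_def vec.span_singleton hforms_homogeneous)

text \<open>The gradient is homogeneous of degree k - 1. Differentiating F(t (v + s u)) in s gives
  this with a factor t on one side and t^k on the other, which also makes sense for k = 0.\<close>

lemma gradient_scale_eq_0_iff:
  assumes F: "F \<in> hforms k" and "t \<noteq> 0"
  shows "cdot (gradient F (t *s v)) u = 0 \<longleftrightarrow> cdot (gradient F v) u = 0"
proof -
  have "((\<lambda>s. F (t *s v + s *s (t *s u))) has_field_derivative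
      cdot (gradient F (t *s v)) (t *s u)) (at 0)"
    using has_gradient_along [of F _ "t *s v" 0 "t *s u"] hforms_has_gradient [OF F] by simp
  moreover have "(\<lambda>s. F (t *s v + s *s (t *s u))) = (\<lambda>s. t ^ k * F (v + s *s u))"
  proof
    fix s
    have "t *s v + s *s (t *s u) = t *s (v + s *s u)"
      by (simp add: vec.scale_right_distrib mult.commute)
    then show "F (t *s v + s *s (t *s u)) = t ^ k * F (v + s *s u)"
      by (simp only: hforms_homogeneous [OF F])
  qed
  moreover have "((\<lambda>s. t ^ k * F (v + s *s u)) has_field_derivative
      t ^ k * cdot (gradient F v) u) (at 0)"
    using has_gradient_along [of F _ v 0 u] hforms_has_gradient [OF F]
    by (intro DERIV_cmult) simp
  ultimately have "t * cdot (gradient F (t *s v)) u = t ^ k * cdot (gradient F v) u"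
    using DERIV_unique by (metis cdot_scale(1))
  then show ?thesis using assms(2) by (metis mult_eq_0_iff power_not_zero)
qed

lemma cdot_all_eq_0_iff: "(\<forall>u. cdot g u = 0) \<longleftrightarrow> g = 0"
proof
  assume *: "\<forall>u. cdot g u = 0"
  have "g $ j = 0" for j using spec [OF *, of "axis j 1"] by simp
  then show "g = 0" by (simp add: vec_eq_iff)
qed simp

subsection \<open>The Veronese variety\<close>

locale veronese_exponents =
  fixes e :: "'m::finite \<Rightarrow> 'n::finite \<Rightarrow> nat" and d :: nat
  assumes e: "bij_betw e UNIV (exponents d)" and d: "2 \<le> d"
begin

lemma e_in: "e j \<in> exponents d"
  using e by (auto simp: bij_betw_def)

definition idx :: "('n \<Rightarrow> nat) \<Rightarrow> 'm" where
  "idx a = (SOME j. e j = a)"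

lemma e_idx:
  assumes "a \<in> exponents d"
  shows "e (idx a) = a"
proof -
  have "a \<in> range e" using assms e by (simp add: bij_betw_def)
  then have "\<exists>j. e j = a" by blast
  then show ?thesis unfolding idx_def by (rule someI_ex)
qed

lemma veronese_vec_nth [simp]: "veronese_vec e v $ j = monomial (e j) v"
  by (simp add: veronese_vec_def)

lemma veronese_vec_scale: "veronese_vec e (c *s v) = c ^ d *s veronese_vec e v"
  by (simp add: vec_eq_iff monomial_scale [OF e_in])

lemma hforms_cdot_veronese: "(\<lambda>z. cdot c (veronese_vec e z)) \<in> hforms d"
  unfolding cdot_def by (auto intro!: hforms_sum hforms_scale hforms_monomial e_in)

lemma hforms_as_functional:
  assumes "F \<in> hforms d"
  obtains c where "F = (\<lambda>z. cdot c (veronese_vec e z))"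
proof -
  obtain b where F: "F = (\<lambda>z. \<Sum>a\<in>exponents d. b a * monomial a z)"
    using assms by (auto simp: hforms_def)
  have "(\<Sum>a\<in>exponents d. b a * monomial a z) = cdot (\<chi> j. b (e j)) (veronese_vec e z)" for z
    using sum.reindex_bij_betw [OF e, of "\<lambda>a. b a * monomial a z"] by (simp add: cdot_def)
  then show ?thesis using that F by blast
qed

text \<open>The differential of the Veronese map at \<open>v\<close> applied to \<open>u\<close>.
  Its range over \<open>u\<close> will be the affine cone over the embedded tangent space.\<close>

definition tvec :: "complex ^ 'n \<Rightarrow> complex ^ 'n \<Rightarrow> complex ^ 'm" where
  "tvec v u = (\<chi> j. cdot (gradient (monomial (e j)) v) u)"

lemma subspace_range_tvec: "vec.subspace (range (tvec v))"
proof (rule vec.subspaceI)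
  show "0 \<in> range (tvec v)"
    by (rule range_eqI [of _ _ 0]) (simp add: tvec_def vec_eq_iff)
  fix x y c assume "x \<in> range (tvec v)" "y \<in> range (tvec v)"
  then obtain a b where ab: "x = tvec v a" "y = tvec v b" by blast
  show "x + y \<in> range (tvec v)"
    by (rule range_eqI [of _ _ "a + b"]) (simp add: ab tvec_def vec_eq_iff cdot_add)
  show "c *s x \<in> range (tvec v)"
    by (rule range_eqI [of _ _ "c *s a"]) (simp add: ab tvec_def vec_eq_iff cdot_scale)
qed

lemma monomial_along:
  "((\<lambda>t. monomial (e j) (v + t *s u)) has_field_derivative tvec v u $ j) (at 0)"
  using has_gradient_along [of "monomial (e j)" _ v 0 u]
    hforms_has_gradient [OF hforms_monomial [OF e_in]] by (simp add: tvec_def)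

lemma veronese_vec_along:
  "((\<lambda>t. veronese_vec e (v + t *s u)) has_derivative (\<lambda>t. t *s tvec v u)) (at 0)"
proof (rule has_derivative_vec)
  fix j
  have "(\<lambda>t. (t *s tvec v u) $ j) = (*) (tvec v u $ j)" by (simp add: fun_eq_iff mult.commute)
  then show "((\<lambda>t. veronese_vec e (v + t *s u) $ j) has_derivative (\<lambda>t. (t *s tvec v u) $ j)) (at 0)"
    using monomial_along [of j v u] by (simp add: has_field_derivative_def)
qed

lemma cdot_tvec:
  "cdot c (tvec v u) = cdot (gradient (\<lambda>z. cdot c (veronese_vec e z)) v) u"
proof -
  let ?F = "\<lambda>z. cdot c (veronese_vec e z)"
  have "((\<lambda>t. ?F (v + t *s u)) has_field_derivative cdot (gradient ?F v) u) (at 0)"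
    using has_gradient_along [of ?F _ v 0 u]
      hforms_has_gradient [OF hforms_cdot_veronese] by simp
  moreover have "((\<lambda>t. ?F (v + t *s u)) has_field_derivative cdot c (tvec v u)) (at 0)"
    unfolding cdot_def veronese_vec_nth by (intro DERIV_sum DERIV_cmult monomial_along)
  ultimately show ?thesis using DERIV_unique by blast
qed

text \<open>Composed with the Veronese map, \<open>F\<close> is the zero function, and the chain
  rule differentiates it. Thus tangent vectors satisfy the linearised equations of the
  variety.\<close>

lemma gradient_chain_veronese:
  assumes F: "F \<in> hforms k" and "\<And>z. F (veronese_vec e z) = 0"
  shows "cdot (gradient F (veronese_vec e v)) (tvec v u) = 0"
proof -
  let ?g = "gradient F (veronese_vec e v)"
  have "(F has_derivative cdot ?g) (at (veronese_vec e (v + 0 *s u)))"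
    using hforms_has_gradient [OF F] by (simp add: has_gradient_def)
  from has_derivative_compose [OF veronese_vec_along this]
  have "((\<lambda>t. F (veronese_vec e (v + t *s u))) has_derivative (\<lambda>t. cdot ?g (t *s tvec v u))) (at 0)" .
  then have "((\<lambda>t::complex. 0) has_derivative (\<lambda>t. cdot ?g (t *s tvec v u))) (at 0)"
    using assms(2) by simp
  then have "(\<lambda>t::complex. cdot ?g (t *s tvec v u)) = (\<lambda>t. 0)"
    by (rule has_derivative_unique) simp
  from fun_cong [OF this, of 1] show ?thesis by simp
qed

text \<open>
  On the chart where the \<open>i0\<close>-th homogeneous coordinate of the source does not vanish, the target
  coordinates \<open>ch i0 i\<close>, belonging to the monomials \<open>z\<^sub>i z\<^sub>i\<^sub>0\<^bsup>d - 1\<^esup>\<close>, determine all the others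
  through the equations \<open>chart_eq i0 k\<close>.
\<close>

definition ch :: "'n \<Rightarrow> 'n \<Rightarrow> 'm" where
  "ch i0 i = idx (\<lambda>k. (if k = i then 1 else 0) + (if k = i0 then d - 1 else 0))"

definition chart_eq :: "'n \<Rightarrow> 'm \<Rightarrow> complex ^ 'm \<Rightarrow> complex" where
  "chart_eq i0 k z = z $ k * z $ ch i0 i0 ^ (d - 1) - (\<Prod>i\<in>UNIV. z $ ch i0 i ^ e k i)"

lemma e_ch: "e (ch i0 i) = (\<lambda>k. (if k = i then 1 else 0) + (if k = i0 then d - 1 else 0))"
  unfolding ch_def using d by (intro e_idx) (simp add: exponents_def sum.distrib)

lemma monomial_ch: "monomial (e (ch i0 i)) v = v $ i * v $ i0 ^ (d - 1)"
  by (simp add: e_ch monomial_def power_add prod.distrib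
      if_distrib [where f = "\<lambda>x. _ ^ x"] cong: if_cong)

lemma monomial_ch_self: "monomial (e (ch i0 i0)) v = v $ i0 ^ d"
  using d by (simp add: monomial_ch power_eq_if)

lemma sum_e: "(\<Sum>i\<in>UNIV. e k i) = d"
  using e_in [of k] by (simp add: exponents_def)

lemma chart_eq_hforms: "chart_eq i0 k \<in> hforms d"
proof -
  have "(\<lambda>z. z $ k * z $ ch i0 i0 ^ (d - 1)) \<in> hforms (1 + (d - 1) * 1)"
    by (intro hforms_mult hforms_power hforms_coord)
  then have 1: "(\<lambda>z. z $ k * z $ ch i0 i0 ^ (d - 1)) \<in> hforms d" using d by simp
  have "(\<lambda>z. \<Prod>i\<in>UNIV. z $ ch i0 i ^ e k i) \<in> hforms (\<Sum>i\<in>UNIV. e k i * 1)"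
    by (intro hforms_prod hforms_power hforms_coord) simp
  then have "(\<lambda>z. \<Prod>i\<in>UNIV. z $ ch i0 i ^ e k i) \<in> hforms d" by (simp add: sum_e)
  from hforms_add [OF 1 hforms_scale [OF this, of "- 1"]]
  show ?thesis by (simp add: chart_eq_def [abs_def])
qed

lemma chart_eq_veronese: "chart_eq i0 k (veronese_vec e v) = 0"
proof -
  have "(\<Prod>i\<in>UNIV. (v $ i * v $ i0 ^ (d - 1)) ^ e k i)
      = monomial (e k) v * (\<Prod>i\<in>UNIV. (v $ i0 ^ (d - 1)) ^ e k i)"
    by (simp add: power_mult_distrib prod.distrib monomial_def)
  also have "(\<Prod>i\<in>UNIV. (v $ i0 ^ (d - 1)) ^ e k i) = (v $ i0 ^ (d - 1)) ^ d"
    by (simp add: power_sum [symmetric] sum_e)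
  also have "\<dots> = (v $ i0 ^ d) ^ (d - 1)" by (simp add: power_mult [symmetric] mult.commute)
  finally show ?thesis
    unfolding chart_eq_def veronese_vec_nth monomial_ch_self by (simp add: monomial_ch)
qed

text \<open>Solving each equation for its non-chart coordinate shows that \<open>z\<close> is, up to
  a factor, the image of the vector of its own chart coordinates; the chart coordinates themselves
  need no equation.\<close>

lemma chart_eq_solved:
  assumes "\<And>k. k \<notin> range (ch i0) \<Longrightarrow> chart_eq i0 k z = 0"
  shows "veronese_vec e (\<chi> i. z $ ch i0 i) = z $ ch i0 i0 ^ (d - 1) *s z"
proof -
  have "monomial (e k) (\<chi> i. z $ ch i0 i) = z $ ch i0 i0 ^ (d - 1) * z $ k" for k
  proof (cases "k \<in> range (ch i0)")
    case True
    then obtain i where "k = ch i0 i" by blast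
    then show ?thesis by (simp add: monomial_ch)
  next
    case False
    then show ?thesis using assms [OF False] by (simp add: chart_eq_def monomial_def mult.commute)
  qed
  then show ?thesis by (simp add: vec_eq_iff)
qed

text \<open>The \<open>k\<close>-th equation involves a single non-chart coordinate, its own, and
  that one linearly. The Jacobian in the non-chart coordinates is therefore a scalar matrix.\<close>

lemma gradient_chart_eq:
  assumes "k \<notin> range (ch i0)" and "k' \<notin> range (ch i0)"
  shows "gradient (chart_eq i0 k) z $ k' = (if k' = k then z $ ch i0 i0 ^ (d - 1) else 0)"
proof -
  have ne: "ch i0 i \<noteq> k'" for i using assms(2) by auto
  have "((\<lambda>t. chart_eq i0 k (z + t *s axis k' 1)) has_field_derivative
      (if k' = k then z $ ch i0 i0 ^ (d - 1) else 0)) (at 0)"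
    unfolding chart_eq_def using ne by (auto simp: axis_def intro!: derivative_eq_intros)
  then show ?thesis by (simp add: gradient_def DERIV_imp_deriv)
qed

section \<open>Representatives of image points, injectivity and smoothness\<close>

lemma veronese_Rep:
  assumes "z \<in> Rep_proj (veronese e p)" and "z \<noteq> 0"
  obtains v where "v \<noteq> 0" "Rep_proj p = vec.span {v}" "z = veronese_vec e v"
proof -
  have "Rep_proj (veronese e p) = vec.span {veronese_vec e (hvec p)}"
    using Rep_proj_veronese [OF e] hvec by blast
  then obtain c where c: "z = c *s veronese_vec e (hvec p)"
    using assms(1) by (auto simp: vec.span_singleton)
  then have "c \<noteq> 0" using assms(2) by auto
  \<comment> \<open>Scaling the source by \<open>b\<close> scales the image by b^d, so reaching
    every multiple \<open>c\<close> takes a complex d-th root.\<close>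
  obtain b where b: "b ^ d = c"
  proof
    show "(exp (Ln c / of_nat d)) ^ d = c"
      using d \<open>c \<noteq> 0\<close> by (simp add: exp_of_nat_mult [symmetric])
  qed
  then have "b \<noteq> 0" using \<open>c \<noteq> 0\<close> d by auto
  show ?thesis
  proof
    show nz: "b *s hvec p \<noteq> 0" using \<open>b \<noteq> 0\<close> hvec(1) by simp
    show "Rep_proj p = vec.span {b *s hvec p}"
      by (rule Rep_proj_eq_span [OF _ nz]) (simp add: hvec(2) vec.span_scale vec.span_base)
    show "z = veronese_vec e (b *s hvec p)" by (simp add: c veronese_vec_scale b)
  qed
qed

lemma veronese_hvec_in_Rep: "veronese_vec e (hvec p) \<in> Rep_proj (veronese e p)"
  and veronese_hvec_nz: "veronese_vec e (hvec p) \<noteq> 0"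
  using Rep_proj_veronese [OF e hvec, of p] by (auto simp: vec.span_base)

text \<open>The chart monomials v_i v_i0^(d-1) determine \<open>v\<close> up to a factor: dividing
  their equality with those of \<open>w\<close> by v_i0^(d-1) gives the scalar
  \<open>c\<close>.\<close>

lemma inj_veronese: "inj (veronese e)"
proof (rule injI)
  fix p q assume eq: "veronese e p = veronese e q"
  define v where "v = hvec p"
  have "veronese_vec e v \<in> Rep_proj (veronese e q)"
    using veronese_hvec_in_Rep [of p] eq by (simp add: v_def)
  moreover have "veronese_vec e v \<noteq> 0" using veronese_hvec_nz by (simp add: v_def)
  ultimately obtain w where w: "w \<noteq> 0" "Rep_proj q = vec.span {w}" "veronese_vec e v = veronese_vec e w"
    by (rule veronese_Rep)
  obtain i0 where i0: "v $ i0 \<noteq> 0" using hvec(1) [of p] by (auto simp: v_def vec_eq_iff)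
  have m: "v $ i * v $ i0 ^ (d - 1) = w $ i * w $ i0 ^ (d - 1)" for i
    using w(3) by (metis monomial_ch veronese_vec_nth)
  have "w $ i0 \<noteq> 0" using m [of i0] i0 d by auto
  define c where "c = (w $ i0 / v $ i0) ^ (d - 1)"
  have "v = c *s w"
    using m i0 by (simp add: vec_eq_iff c_def field_simps)
  then have "v \<in> Rep_proj q" by (simp add: w(2) vec.span_scale vec.span_base)
  then show "p = q" using proj_eqI [of v p q] hvec(1) [of p] hvec_in_Rep [of p] by (simp add: v_def)
qed

text \<open>Witnesses for the Jacobian condition at a point whose \<open>i0\<close>-th source
  coordinate is nonzero: the chart equations of all non-chart coordinates, and for \<open>G\<close>
  the coordinate \<open>ch i0 i0\<close>, which on the image is the d-th power of that source
  coordinate.\<close>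

lemma smooth_locus_veronese: "smooth_locus (veronese_variety e) = veronese_variety e"
proof
  show "smooth_locus (veronese_variety e) \<subseteq> veronese_variety e" by (auto simp: smooth_locus_def)
  show "veronese_variety e \<subseteq> smooth_locus (veronese_variety e)"
  proof
    fix P assume PV: "P \<in> veronese_variety e"
    then obtain p where P: "P = veronese e p" by (auto simp: veronese_variety_def)
    obtain i0 where i0: "hvec p $ i0 \<noteq> 0" using hvec(1) [of p] by (auto simp: vec_eq_iff)
    define K where "K = - range (ch i0)"
    define S where "S = chart_eq i0 ` K"
    define G where "G = (\<lambda>z::complex^'m. z $ ch i0 i0)"
    have G: "G \<in> hforms 1" unfolding G_def by (rule hforms_coord)
    have z0: "z $ ch i0 i0 \<noteq> 0" if "z \<in> Rep_proj P - {0}" for z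
    proof -
      obtain v where v: "v \<noteq> 0" "Rep_proj p = vec.span {v}" "z = veronese_vec e v"
        using \<open>z \<in> Rep_proj P - {0}\<close> P veronese_Rep [of z p] by blast
      obtain c where "hvec p = c *s v" using hvec_in_Rep [of p] by (auto simp: v(2) vec.span_singleton)
      then have "v $ i0 \<noteq> 0" using i0 by auto
      then show ?thesis by (simp add: v(3) monomial_ch_self)
    qed
    have 1: "\<not> vanishes_at G P"
    proof -
      have "veronese_vec e (hvec p) \<in> Rep_proj P - {0}"
        using veronese_hvec_in_Rep veronese_hvec_nz by (auto simp: P)
      then show ?thesis using z0 unfolding vanishes_at_def G_def by blast
    qed
    have 2: "q \<in> veronese_variety e \<longleftrightarrow> (\<forall>F\<in>S. vanishes_at F q)" if q: "\<not> vanishes_at G q" for q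
    proof
      assume "q \<in> veronese_variety e"
      then obtain p' where q': "q = veronese e p'" by (auto simp: veronese_variety_def)
      show "\<forall>F\<in>S. vanishes_at F q"
        using vanishes_at_iff [OF chart_eq_hforms veronese_hvec_in_Rep veronese_hvec_nz]
        by (auto simp: S_def q' chart_eq_veronese)
    next
      assume S: "\<forall>F\<in>S. vanishes_at F q"
      \<comment> \<open>The candidate preimage reads its coordinates off the chart coordinates of
        \<open>q\<close>.\<close>
      let ?z = "hvec q" and ?u = "\<chi> i. hvec q $ ch i0 i"
      have z: "?z $ ch i0 i0 \<noteq> 0"
        using q vanishes_at_iff [OF G hvec_in_Rep hvec(1)] by (simp add: G_def)
      have "chart_eq i0 k ?z = 0" if "k \<notin> range (ch i0)" for k
        using S that hvec_in_Rep by (auto simp: S_def K_def vanishes_at_def)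
      then have eq: "veronese_vec e ?u = ?z $ ch i0 i0 ^ (d - 1) *s ?z" by (rule chart_eq_solved)
      have "?u \<noteq> 0" using z by (auto simp: vec_eq_iff)
      then obtain p' where p': "Rep_proj p' = vec.span {?u}" by (rule ex_proj)
      have R: "Rep_proj (veronese e p') = vec.span {veronese_vec e ?u}" and nz: "veronese_vec e ?u \<noteq> 0"
        using Rep_proj_veronese [OF e \<open>?u \<noteq> 0\<close> p'] by blast+
      have "veronese_vec e ?u \<in> Rep_proj q"
        unfolding eq hvec(2) by (simp add: vec.span_scale vec.span_base)
      then have "q = veronese e p'"
        using proj_eqI [of "veronese_vec e ?u" q] R nz by (simp add: vec.span_base)
      then show "q \<in> veronese_variety e" by (simp add: veronese_variety_def)
    qed
    have 3: "inj_on (\<lambda>F. gradient F z) S \<and> vec.independent ((\<lambda>F. gradient F z) ` S)"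
      if z: "z \<in> Rep_proj P - {0}" for z
    proof -
      define \<gamma> where "\<gamma> k = gradient (chart_eq i0 k) z" for k
      have \<gamma>: "\<gamma> k $ k' = (if k' = k then z $ ch i0 i0 ^ (d - 1) else 0)" if "k \<in> K" "k' \<in> K" for k k'
        using that by (simp add: \<gamma>_def K_def gradient_chart_eq)
      have inj: "inj_on \<gamma> K"
      proof (rule inj_onI)
        fix k k' assume "k \<in> K" "k' \<in> K" "\<gamma> k = \<gamma> k'"
        then show "k = k'" using \<gamma> [of k k] \<gamma> [of k' k] z0 [OF z] by (auto split: if_splits)
      qed
      have im: "(\<lambda>F. gradient F z) ` S = \<gamma> ` K" by (auto simp: S_def \<gamma>_def)
      have "vec.independent (\<gamma> ` K)"
      proof (rule vec.independent_if_scalars_zero)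
        fix f x assume s: "(\<Sum>x\<in>\<gamma> ` K. f x *s x) = 0" and "x \<in> \<gamma> ` K"
        then obtain k where k: "k \<in> K" "x = \<gamma> k" by blast
        \<comment> \<open>The \<open>k\<close>-th entry of the combination isolates the coefficient
          of \<open>\<gamma> k\<close>, because the Jacobian is scalar there.\<close>
        have "0 = (\<Sum>j\<in>K. f (\<gamma> j) *s \<gamma> j) $ k" using s by (simp add: sum.reindex [OF inj])
        also have "\<dots> = (\<Sum>j\<in>K. if j = k then f (\<gamma> k) * z $ ch i0 i0 ^ (d - 1) else 0)"
          unfolding sum_component using k(1) by (intro sum.cong) (auto simp: \<gamma>)
        also have "\<dots> = f x * z $ ch i0 i0 ^ (d - 1)" using k by simp
        finally show "f x = 0" using z0 [OF z] by simp
      qed simp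
      moreover have "inj_on (\<lambda>F. gradient F z) S"
        unfolding S_def using inj by (intro inj_on_imageI) (simp add: \<gamma>_def [abs_def] o_def)
      ultimately show ?thesis by (simp add: im)
    qed
    have "finite S" "S \<subseteq> forms" "G \<in> forms"
      using chart_eq_hforms G by (auto simp: S_def forms_eq_Union_hforms)
    with 1 2 3 PV show "P \<in> smooth_locus (veronese_variety e)" unfolding smooth_locus_def by blast
  qed
qed

section \<open>Embedded tangent spaces of the Veronese variety\<close>

lemma tvec_ch:
  "tvec v u $ ch i0 i = u $ i * v $ i0 ^ (d - 1) + of_nat (d - 1) * v $ i * v $ i0 ^ (d - 2) * u $ i0"
proof -
  have "((\<lambda>t. monomial (e (ch i0 i)) (v + t *s u)) has_field_derivative
     (u $ i * v $ i0 ^ (d - 1) + of_nat (d - 1) * v $ i * v $ i0 ^ (d - 2) * u $ i0)) (at 0)"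
    unfolding monomial_ch
    by (auto intro!: derivative_eq_intros simp: algebra_simps numeral_2_eq_2)
  then show ?thesis using DERIV_unique monomial_along by blast
qed

text \<open>In chart coordinates the differential is onto, so a candidate tangent vector can be
  matched there and only the remaining coordinates have to be compared.\<close>

lemma tvec_surj_chart:
  assumes "v $ i0 \<noteq> 0"
  obtains u where "\<And>i. tvec v u $ ch i0 i = w $ ch i0 i"
proof
  \<comment> \<open>For \<open>i = i0\<close> the two terms of \<open>tvec_ch\<close> add up to d
    v_i0^(d-1) u_i0, which forces u_i0 to be \<open>a\<close>. The other entries of \<open>u\<close>
    are then solved with this value, and the computation below checks that \<open>u $ i0\<close> is
    indeed \<open>a\<close>.\<close>
  define a where "a = w $ ch i0 i0 / (of_nat d * v $ i0 ^ (d - 1))"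
  define u :: "complex ^ 'n" where
    "u = (\<chi> i. (w $ ch i0 i - of_nat (d - 1) * v $ i * v $ i0 ^ (d - 2) * a) / v $ i0 ^ (d - 1))"
  have pw: "v $ i0 * v $ i0 ^ (d - 2) = v $ i0 ^ (d - 1)"
  proof -
    have "Suc (d - 2) = d - 1" using d by arith
    then show ?thesis by (metis power_Suc)
  qed
  have w: "w $ ch i0 i0 = of_nat d * v $ i0 ^ (d - 1) * a"
    using assms d by (simp add: a_def)
  have "u $ i0 = (w $ ch i0 i0 - of_nat (d - 1) * (v $ i0 * v $ i0 ^ (d - 2)) * a) / v $ i0 ^ (d - 1)"
    by (simp add: u_def mult.assoc)
  also have "\<dots> = (of_nat d * v $ i0 ^ (d - 1) * a - of_nat (d - 1) * v $ i0 ^ (d - 1) * a) / v $ i0 ^ (d - 1)"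
    unfolding pw w by simp
  also have "\<dots> = (of_nat d - of_nat (d - 1)) * a" using assms by (simp add: field_simps)
  also have "\<dots> = a" using d by (simp add: of_nat_diff)
  finally have ua: "u $ i0 = a" .
  show "tvec v u $ ch i0 i = w $ ch i0 i" for i
    unfolding tvec_ch ua using assms by (simp add: u_def)
qed

text \<open>The chain rule puts the range of the differential into the tangent space. For the
  converse the chart equations, which belong to the ideal, already cut the tangent space down to
  that range.\<close>

lemma tangent_space_veronese:
  "tangent_space (veronese_variety e) (veronese e p) = linear_locus (range (tvec (hvec p)))"
proof
  let ?V = "veronese_variety e" and ?v = "hvec p"
  show "linear_locus (range (tvec ?v)) \<subseteq> tangent_space ?V (veronese e p)"
  proof
    fix q assume q: "q \<in> linear_locus (range (tvec ?v))"
    show "q \<in> tangent_space ?V (veronese e p)"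
      unfolding tangent_space_def mem_Collect_eq cdot_def [symmetric]
    proof (intro ballI)
      fix F z w assume F: "F \<in> ideal_forms ?V" and z: "z \<in> Rep_proj (veronese e p) - {0}"
        and w: "w \<in> Rep_proj q"
      obtain k where k: "F \<in> hforms k" using F by (auto simp: ideal_forms_def forms_eq_Union_hforms)
      have van: "F (veronese_vec e x) = 0" for x
      proof (cases "x = 0")
        case True
        have "\<forall>y\<in>Rep_proj (veronese e p). F y = 0"
          using F by (auto simp: ideal_forms_def vanishes_at_def veronese_variety_def)
        moreover have "veronese_vec e x = 0 *s veronese_vec e ?v"
          using veronese_vec_scale [of 0 ?v] d by (simp add: True)
        ultimately show ?thesis
          using veronese_hvec_in_Rep [of p] by (metis hvec(2) vec.span_scale)
      next
        case False
        then obtain p' where p': "Rep_proj p' = vec.span {x}" by (rule ex_proj)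
        then have "veronese_vec e x \<in> Rep_proj (veronese e p')"
          using Rep_proj_veronese [OF e False p'] by (simp add: vec.span_base)
        then show ?thesis using F by (auto simp: ideal_forms_def vanishes_at_def veronese_variety_def)
      qed
      obtain u where u: "w = tvec ?v u" using q w by (auto simp: linear_locus_def)
      have "Rep_proj (veronese e p) = vec.span {veronese_vec e ?v}"
        using Rep_proj_veronese [OF e hvec] by blast
      then obtain c where c: "z = c *s veronese_vec e ?v" using z by (auto simp: vec.span_singleton)
      then have "c \<noteq> 0" using z by auto
      then show "cdot (gradient F z) w = 0"
        using gradient_chain_veronese [OF k van] gradient_scale_eq_0_iff [OF k] by (simp add: c u)
    qed
  qed
  show "tangent_space ?V (veronese e p) \<subseteq> linear_locus (range (tvec ?v))"
  proof
    fix q assume q: "q \<in> tangent_space ?V (veronese e p)"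
    obtain i0 where i0: "?v $ i0 \<noteq> 0" using hvec(1) [of p] by (auto simp: vec_eq_iff)
    have "w \<in> range (tvec ?v)" if w: "w \<in> Rep_proj q" for w
    proof -
      obtain u where u: "\<And>i. tvec ?v u $ ch i0 i = w $ ch i0 i"
        using tvec_surj_chart [OF i0] by blast
      have "w $ k = tvec ?v u $ k" for k
      proof (cases "k \<in> range (ch i0)")
        case False
        let ?g = "gradient (chart_eq i0 k) (veronese_vec e ?v)"
        have "chart_eq i0 k \<in> ideal_forms ?V"
        proof -
          have "vanishes_at (chart_eq i0 k) (veronese e p')" for p'
            using vanishes_at_iff [OF chart_eq_hforms veronese_hvec_in_Rep veronese_hvec_nz]
            by (simp add: chart_eq_veronese)
          then show ?thesis using chart_eq_hforms
            by (auto simp: ideal_forms_def forms_eq_Union_hforms veronese_variety_def)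
        qed
        moreover have "veronese_vec e ?v \<in> Rep_proj (veronese e p) - {0}"
          using veronese_hvec_in_Rep veronese_hvec_nz by auto
        ultimately have "cdot ?g w = 0"
          using q w unfolding tangent_space_def cdot_def by blast
        moreover have "cdot ?g (tvec ?v u) = 0"
          by (rule gradient_chain_veronese [OF chart_eq_hforms chart_eq_veronese])
        \<comment> \<open>The difference vanishes in the chart coordinates, and among the others the
          gradient has only its \<open>k\<close>-th entry. The pairing is thus a nonzero multiple of
          the \<open>k\<close>-th coordinate of the difference.\<close>
        ultimately have "0 = cdot ?g (w - tvec ?v u)" by (simp add: cdot_diff)
        also have "\<dots> = (\<Sum>j\<in>UNIV. if j = k then (?v $ i0 ^ d) ^ (d - 1) * (w $ k - tvec ?v u $ k) else 0)"
          unfolding cdot_def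
        proof (rule sum.cong)
          fix j
          show "?g $ j * (w - tvec ?v u) $ j =
              (if j = k then (?v $ i0 ^ d) ^ (d - 1) * (w $ k - tvec ?v u $ k) else 0)"
          proof (cases "j \<in> range (ch i0)")
            case True
            then show ?thesis using False u by auto
          next
            case j: False
            show ?thesis using gradient_chart_eq [OF False j] by (simp add: monomial_ch_self)
          qed
        qed simp
        also have "\<dots> = (?v $ i0 ^ d) ^ (d - 1) * (w $ k - tvec ?v u $ k)" by simp
        finally show ?thesis using i0 by simp
      qed (use u in auto)
      then have "w = tvec ?v u" by (simp add: vec_eq_iff)
      then show ?thesis by blast
    qed
    then show "q \<in> linear_locus (range (tvec ?v))" by (auto simp: linear_locus_def)
  qed
qed

lemma veronese_in_double_span_iff:
  "veronese e q \<in> double_span (veronese_variety e) (veronese e ` A) \<longleftrightarrow>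
    (\<forall>F\<in>hforms d. (\<forall>p\<in>A. gradient F (hvec p) = 0) \<longrightarrow> F (hvec q) = 0)"
proof -
  let ?T = "\<Union>p\<in>A. range (tvec (hvec p))"
  have "double_span (veronese_variety e) (veronese e ` A) = linear_locus (vec.span ?T)"
  proof -
    have "(\<Union>P\<in>veronese e ` A. tangent_space (veronese_variety e) P)
        = (\<Union>p\<in>A. linear_locus (range (tvec (hvec p))))"
      by (simp add: tangent_space_veronese)
    then show ?thesis
      unfolding double_span_def proj_span_def
      by (simp add: span_Union_Rep_linear_locus subspace_range_tvec del: UN_simps)
  qed
  moreover have "Rep_proj (veronese e q) = vec.span {veronese_vec e (hvec q)}"
    using Rep_proj_veronese [OF e hvec] by blast
  then have "veronese e q \<in> linear_locus (vec.span ?T) \<longleftrightarrow> veronese_vec e (hvec q) \<in> vec.span ?T"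
    unfolding linear_locus_def
    by (metis (no_types, lifting) empty_subsetI insert_subset mem_Collect_eq vec.span_base
        vec.span_minimal vec.subspace_span singletonI subsetD)
  moreover have "veronese_vec e (hvec q) \<in> vec.span ?T \<longleftrightarrow>
    (\<forall>F\<in>hforms d. (\<forall>p\<in>A. gradient F (hvec p) = 0) \<longrightarrow> F (hvec q) = 0)"
  proof (intro iffI ballI impI)
    fix F :: "complex ^ 'n \<Rightarrow> complex"
    assume sp: "veronese_vec e (hvec q) \<in> vec.span ?T" and "F \<in> hforms d"
      and A: "\<forall>p\<in>A. gradient F (hvec p) = 0"
    obtain c where c: "F = (\<lambda>z. cdot c (veronese_vec e z))"
      using \<open>F \<in> hforms d\<close> by (rule hforms_as_functional)
    have "vec.span ?T \<subseteq> {w. cdot c w = 0}"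
    proof (rule vec.span_minimal)
      show "?T \<subseteq> {w. cdot c w = 0}" using A by (auto simp: cdot_tvec c [symmetric])
      show "vec.subspace {w. cdot c w = 0}" by (rule vec.subspaceI) (auto simp: cdot_add cdot_scale)
    qed
    then show "F (hvec q) = 0" using sp by (auto simp: c)
  next
    assume R: "\<forall>F\<in>hforms d. (\<forall>p\<in>A. gradient F (hvec p) = 0) \<longrightarrow> F (hvec q) = 0"
    show "veronese_vec e (hvec q) \<in> vec.span ?T"
    proof (rule ccontr)
      assume "veronese_vec e (hvec q) \<notin> vec.span ?T"
      then obtain c where c: "\<And>w. w \<in> vec.span ?T \<Longrightarrow> cdot c w = 0"
        and nz: "cdot c (veronese_vec e (hvec q)) \<noteq> 0"
        using separating_functional [of "veronese_vec e (hvec q)" ?T] by blast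
      let ?F = "\<lambda>z. cdot c (veronese_vec e z)"
      have "gradient ?F (hvec p) = 0" if "p \<in> A" for p
      proof -
        have "cdot c (tvec (hvec p) u) = 0" for u
          using that by (intro c vec.span_base) blast
        then show ?thesis by (simp add: cdot_tvec flip: cdot_all_eq_0_iff)
      qed
      then show False using R nz hforms_cdot_veronese [of c] by blast
    qed
  qed
  ultimately show ?thesis by simp
qed

end

subsection \<open>Lines\<close>

text \<open>A line only for distinct points; for \<open>p = q\<close> it is the single point
  \<open>p\<close>.\<close>

definition jline :: "'n::finite proj \<Rightarrow> 'n proj \<Rightarrow> 'n proj set" where
  "jline p q = linear_locus (vec.span {hvec p, hvec q})"

lemma in_jline_iff: "x \<in> jline p q \<longleftrightarrow> hvec x \<in> vec.span {hvec p, hvec q}"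
  by (simp add: jline_def in_linear_locus_iff)

lemma in_jline [simp]: "p \<in> jline p q" "q \<in> jline p q"
  by (simp_all add: in_jline_iff vec.span_base)

lemma hvec_notin_span:
  assumes "p \<noteq> q"
  shows "hvec p \<notin> vec.span {hvec q}"
  using assms proj_eqI [of "hvec p" p q] hvec(1) [of p] hvec_in_Rep [of p] by (auto simp: hvec(2) [of q])

lemma hvec_independent:
  assumes "p \<noteq> q"
  shows "vec.independent {hvec p, hvec q}" and "hvec p \<noteq> hvec q"
proof -
  show "hvec p \<noteq> hvec q" using hvec_notin_span [OF assms] by (auto simp: vec.span_base)
  then show "vec.independent {hvec p, hvec q}"
    using hvec_notin_span [OF assms] hvec(1) [of q] by (simp add: vec.independent_insert)
qed

lemma proj_line_jline:
  assumes "p \<noteq> q"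
  shows "proj_line (jline p q)"
proof -
  have "vec.dim (vec.span {hvec p, hvec q}) = 2"
    using hvec_independent [OF assms] by (simp add: vec.dim_span vec.dim_eq_card_independent)
  then show ?thesis unfolding proj_line_def jline_def using vec.subspace_span by blast
qed

lemma proj_line_eq_jline:
  assumes "proj_line L" and "p \<in> L" and "q \<in> L" and "p \<noteq> q"
  shows "L = jline p q"
proof -
  obtain W where W: "vec.subspace W" "vec.dim W = 2" "L = linear_locus W"
    using assms(1) by (auto simp: proj_line_def)
  have in_W: "{hvec p, hvec q} \<subseteq> W" using assms(2,3) by (simp add: W in_linear_locus_iff)
  then have "W \<subseteq> vec.span {hvec p, hvec q}"
    using hvec_independent [OF assms(4)] W(2) by (intro vec.card_ge_dim_independent) auto
  moreover have "vec.span {hvec p, hvec q} \<subseteq> W" using in_W W(1) by (rule vec.span_minimal)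
  ultimately show ?thesis by (simp add: W(3) jline_def)
qed

lemma proj_line_unique:
  assumes "proj_line L" "proj_line R" "p \<noteq> q" "p \<in> L" "q \<in> L" "p \<in> R" "q \<in> R"
  shows "L = R"
  using assms by (metis proj_line_eq_jline)

text \<open>The points [a + t b] are pairwise distinct for complex t. Infinitude gives points of a
  line outside a finite set, and collinear sets of any size.\<close>

lemma infinite_proj_line:
  assumes "proj_line L"
  shows "infinite L"
proof -
  obtain W where W: "vec.subspace W" "vec.dim W = 2" "L = linear_locus W"
    using assms by (auto simp: proj_line_def)
  obtain B where B: "B \<subseteq> W" "vec.independent B" "W \<subseteq> vec.span B" "card B = 2"
    using vec.basis_exists [of W] W(2) by metis
  then obtain a b where ab: "B = {a, b}" "a \<noteq> b" by (meson card_2_iff)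
  then have na: "a \<notin> vec.span {b}" and nb: "b \<noteq> 0"
    using B(2) by (auto simp: vec.independent_insert vec.dependent_zero)
  have nz: "a + t *s b \<noteq> 0" for t
  proof
    assume "a + t *s b = 0"
    then have "a = (- t) *s b" by (simp add: eq_neg_iff_add_eq_0 vec.scale_minus_left)
    then show False using na by (metis insertI1 vec.span_base vec.span_scale)
  qed
  define f where "f t = Abs_proj (vec.span {a + t *s b})" for t
  have f: "Rep_proj (f t) = vec.span {a + t *s b}" for t
    unfolding f_def using nz by (intro Abs_proj_inverse) auto
  have "inj f"
  proof (rule injI)
    fix s t assume "f s = f t"
    then have "a + s *s b \<in> vec.span {a + t *s b}" by (metis f insertI1 vec.span_base)
    then obtain c where "a + s *s b = c *s (a + t *s b)" by (auto simp: vec.span_singleton)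
    then have eq: "(1 - c) *s a = (c * t - s) *s b" by (simp add: vec_eq_iff algebra_simps)
    have c: "c = 1"
    proof (rule ccontr)
      assume "c \<noteq> 1"
      then have "a = inverse (1 - c) *s ((1 - c) *s a)"
        unfolding vec.scale_scale by simp
      also note eq
      finally show False using na by (metis insertI1 vec.span_base vec.span_scale)
    qed
    then have "(t - s) *s b = 0" using eq by simp
    then show "s = t" using nb by simp
  qed
  then have "infinite (range f)" using infinite_UNIV_char_0 finite_imageD by blast
  moreover have "range f \<subseteq> L"
  proof
    fix p assume "p \<in> range f"
    then obtain t where "p = f t" by blast
    moreover have "a + t *s b \<in> W"
      using B(1) W(1) by (simp add: ab vec.subspace_add vec.subspace_scale)
    ultimately show "p \<in> L" using W(1) by (simp add: W(3) linear_locus_def f vec.span_minimal)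
  qed
  ultimately show ?thesis using finite_subset by blast
qed

lemma hforms_vanish_on_line:
  assumes F: "F \<in> hforms d" and d: "d \<ge> 1" and "finite A" and L: "proj_line L"
    and card: "d + 1 \<le> 2 * card (L \<inter> A)"
    and sing: "\<And>p. p \<in> A \<Longrightarrow> gradient F (hvec p) = 0" and q: "q \<in> L"
  shows "F (hvec q) = 0"
proof (cases "q \<in> A")
  case True
  then show ?thesis using hforms_euler [OF F, of "hvec q"] sing d by simp
next
  case False
  \<comment> \<open>With \<open>q\<close> as origin of the affine parameter on \<open>L\<close>, the
    claim is read off at parameter 0.\<close>
  define Q where "Q = hvec q"
  have "L \<inter> A \<noteq> {}" using card by auto
  then obtain p0 where p0: "p0 \<in> L" "p0 \<in> A" by blast
  then have "q \<noteq> p0" using False by blast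
  then have L': "L = jline q p0" using proj_line_eq_jline [OF L q p0(1)] by blast
  have "\<exists>a b. hvec p = a *s Q + b *s hvec p0 \<and> b \<noteq> 0" if "p \<in> L \<inter> A" for p
  proof -
    have "hvec p \<in> vec.span {Q, hvec p0}" using that by (simp add: L' in_jline_iff Q_def)
    then obtain a where "hvec p - a *s Q \<in> vec.span {hvec p0}" by (auto simp: vec.span_insert)
    then obtain b where "hvec p - a *s Q = b *s hvec p0" by (auto simp: vec.span_singleton)
    then have eq: "hvec p = a *s Q + b *s hvec p0" by (simp add: algebra_simps)
    have "b \<noteq> 0"
    proof
      assume "b = 0"
      then have "hvec p \<in> vec.span {hvec q}"
        using eq by (simp add: Q_def vec.span_scale vec.span_base)
      then show False using hvec_notin_span [of p q] that False by auto
    qed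
    then show ?thesis using eq by blast
  qed
  then obtain a b where ab: "\<And>p. p \<in> L \<inter> A \<Longrightarrow> hvec p = a p *s Q + b p *s hvec p0 \<and> b p \<noteq> 0"
    by metis
  \<comment> \<open>\<open>\<tau>\<close> keeps the second basis vector \<open>u\<close> of \<open>L\<close> off \<open>A\<close>, so that all points of \<open>L \<inter> A\<close> have the form \<open>Q + s u\<close>.\<close>
  obtain \<tau> where \<tau>: "\<tau> \<notin> (\<lambda>p. a p / b p) ` (L \<inter> A)"
    using ex_new_if_finite [OF infinite_UNIV_char_0, of "(\<lambda>p. a p / b p) ` (L \<inter> A)"] \<open>finite A\<close> by blast
  define u where "u = hvec p0 + \<tau> *s Q"
  define c where "c p = a p - b p * \<tau>" for p
  define s where "s p = b p / c p" for p
  have c: "c p \<noteq> 0" if "p \<in> L \<inter> A" for p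
  proof
    assume "c p = 0"
    then have "\<tau> = a p / b p" using ab [OF that] by (simp add: c_def field_simps)
    then show False using \<tau> that by blast
  qed
  have hp: "hvec p = c p *s (Q + s p *s u)" if "p \<in> L \<inter> A" for p
  proof -
    have "c p *s (Q + s p *s u) = c p *s Q + b p *s u"
      using c [OF that] by (simp add: s_def vec.scale_right_distrib)
    also have "\<dots> = a p *s Q + b p *s hvec p0"
      by (simp add: vec_eq_iff c_def u_def algebra_simps)
    finally show ?thesis using ab [OF that] by simp
  qed
  have inj: "inj_on s (L \<inter> A)"
  proof (rule inj_onI)
    fix p p' assume p: "p \<in> L \<inter> A" "p' \<in> L \<inter> A" "s p = s p'"
    have "hvec p = (c p / c p') *s hvec p'"
      using hp [OF p(1)] hp [OF p(2)] c [OF p(2)] p(3) by simp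
    then have "hvec p \<in> vec.span {hvec p'}" by (metis insertI1 vec.span_base vec.span_scale)
    then show "p = p'" using hvec_notin_span by blast
  qed
  obtain P where P: "degree P \<le> d" "\<And>x. poly P x = F (Q + x *s u)"
    using hforms_along_line [OF F] by blast
  have "P = 0"
  proof (rule double_roots_imp_zero)
    show "finite (s ` (L \<inter> A))" using \<open>finite A\<close> by simp
    show "degree P < 2 * card (s ` (L \<inter> A))" using card P(1) by (simp add: card_image [OF inj])
    fix x assume "x \<in> s ` (L \<inter> A)"
    then obtain p where p: "p \<in> L \<inter> A" "x = s p" by blast
    have "c p *s (Q + x *s u) = hvec p" unfolding p(2) using hp [OF p(1)] by (rule sym)
    then have g: "gradient F (c p *s (Q + x *s u)) = 0" using sing p(1) by (metis IntD2)
    have "F (c p *s (Q + x *s u)) = 0"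
      using hforms_euler [OF F, of "c p *s (Q + x *s u)"] g d by simp
    then have "c p ^ d * poly P x = 0" unfolding P(2) hforms_homogeneous [OF F, symmetric] .
    then have "poly P x = 0" using c [OF p(1)] by simp
    moreover have "cdot (gradient F (Q + x *s u)) u = 0"
      using gradient_scale_eq_0_iff [OF F c [OF p(1)]] g by (metis cdot_zero(1))
    moreover have "((\<lambda>x. poly P x) has_field_derivative cdot (gradient F (Q + x *s u)) u) (at x)"
      unfolding P(2) by (intro has_gradient_along hforms_has_gradient [OF F])
    then have "poly (pderiv P) x = cdot (gradient F (Q + x *s u)) u"
      using DERIV_unique poly_DERIV by blast
    ultimately show "poly P x = 0 \<and> poly (pderiv P) x = 0" by simp
  qed
  then show ?thesis using P(2) [of 0] by (simp add: Q_def)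
qed

subsection \<open>Products of linear forms\<close>

text \<open>With two factors vanishing at \<open>v\<close>, every term of the product rule still
  contains one of them.\<close>

lemma gradient_prod_linear:
  assumes "finite I" "a \<in> I" "b \<in> I" "a \<noteq> b" "cdot (l a) v = 0" "cdot (l b) v = 0"
  shows "gradient (\<lambda>z. \<Prod>i\<in>I. cdot (l i) z) v = 0"
proof -
  define R where "R z = (\<Prod>i\<in>I - {a} - {b}. cdot (l i) z)" for z
  have "R \<in> hforms (\<Sum>i\<in>I - {a} - {b}. 1)"
    unfolding R_def [abs_def] using assms(1) by (intro hforms_prod hforms_cdot) simp
  then have "has_gradient R (gradient R v) v" by (rule hforms_has_gradient)
  from has_gradient_mult [OF has_gradient_mult [OF has_gradient_cdot has_gradient_cdot] this, of "l a" "l b"]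
  have "has_gradient (\<lambda>z. cdot (l a) z * cdot (l b) z * R z) 0 v" using assms by simp
  moreover have "(\<lambda>z. \<Prod>i\<in>I. cdot (l i) z) = (\<lambda>z. cdot (l a) z * cdot (l b) z * R z)"
    using assms by (simp add: fun_eq_iff R_def prod.remove [of I a] prod.remove [of "I - {a}" b] mult.assoc)
  ultimately show ?thesis using gradient_eqI by metis
qed

text \<open>Sort by \<open>g\<close>: each fibre then occupies at most \<open>m\<close> consecutive positions.\<close>

lemma ex_spread_list:
  assumes "finite A" and fib: "\<And>p. p \<in> A \<Longrightarrow> card {p'\<in>A. g p' = g p} \<le> m"
  obtains xs where "distinct xs" "set xs = A"
    "\<And>i j. i < j \<Longrightarrow> j < length xs \<Longrightarrow> m \<le> j - i \<Longrightarrow> g (xs ! i) \<noteq> g (xs ! j)"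
proof -
  obtain ys where ys: "set ys = A" "distinct ys" using finite_distinct_list [OF assms(1)] by blast
  \<comment> \<open>The values of \<open>g\<close> carry no order; an injection into the naturals
    provides the sort key.\<close>
  obtain h :: "_ \<Rightarrow> nat" where h: "inj_on h (g ` A)"
    using assms(1) by (meson finite_imageI finite_imp_inj_to_nat_seg)
  define xs where "xs = sort_key (h \<circ> g) ys"
  have xs: "set xs = A" "distinct xs" using ys by (simp_all add: xs_def)
  have sorted: "h (g (xs ! i)) \<le> h (g (xs ! j))" if "i \<le> j" "j < length xs" for i j
  proof -
    have "sorted (map (h \<circ> g) xs)" unfolding xs_def by (rule sorted_sort_key)
    from sorted_nth_mono [OF this that(1)] show ?thesis using that by simp
  qed
  show ?thesis
  proof (rule that [OF xs(2,1)])
    fix i j assume ij: "i < j" "j < length xs" "m \<le> j - i"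
    show "g (xs ! i) \<noteq> g (xs ! j)"
    proof
      assume eq: "g (xs ! i) = g (xs ! j)"
      \<comment> \<open>Between two positions with equal value, sortedness keeps \<open>g\<close>
        constant, so j - i + 1 > m distinct entries would lie in one fibre.\<close>
      have "(!) xs ` {i..j} \<subseteq> {p'\<in>A. g p' = g (xs ! i)}"
      proof (intro image_subsetI CollectI conjI)
        fix k assume k: "k \<in> {i..j}"
        then show "xs ! k \<in> A" using ij xs(1) by auto
        have "h (g (xs ! k)) = h (g (xs ! i))"
          using sorted [of i k] sorted [of k j] k ij eq by auto
        then show "g (xs ! k) = g (xs ! i)"
          using inj_onD [OF h] k ij xs(1) by (metis atLeastAtMost_iff imageI le_less_trans less_trans nth_mem)
      qed
      then have "card ((!) xs ` {i..j}) \<le> card {p'\<in>A. g p' = g (xs ! i)}"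
        using assms(1) by (intro card_mono) auto
      also have "\<dots> \<le> m" using fib xs(1) ij by (meson less_trans nth_mem)
      finally have "card ((!) xs ` {i..j}) \<le> m" .
      moreover have "card ((!) xs ` {i..j}) = Suc j - i"
        using xs(2) ij by (subst card_image) (auto intro!: inj_on_nth)
      ultimately show False using ij by linarith
    qed
  qed
qed

text \<open>
  The points are listed so that those on a common line through \<open>q\<close> are adjacent.  As such a line
  has at most \<open>d div 2\<close> of them, points whose positions differ cyclically (modulo \<open>d\<close>) by
  \<open>d div 2\<close> are not collinear with \<open>q\<close>, so some hyperplane through both avoids \<open>q\<close>; every point is
  on two of these \<open>d\<close> hyperplanes.
\<close>

lemma ex_singular_form_nonvanishing:
  fixes A :: "'n::finite proj set"
  assumes "finite A" and "card A \<le> d" and d: "2 \<le> d" and "q \<notin> A"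
    and few: "\<And>L. proj_line L \<Longrightarrow> q \<in> L \<Longrightarrow> 2 * card (L \<inter> A) \<le> d"
  obtains F where "F \<in> hforms d" "\<And>p. p \<in> A \<Longrightarrow> gradient F (hvec p) = 0" "F (hvec q) \<noteq> 0"
proof -
  define g where "g p = vec.span {hvec q, hvec p}" for p
  define m where "m = d div 2"
  have "card {p'\<in>A. g p' = g p} \<le> m" if "p \<in> A" for p
  proof -
    have "q \<noteq> p" using that assms(4) by blast
    have "{p'\<in>A. g p' = g p} \<subseteq> jline q p \<inter> A"
    proof
      fix p' assume "p' \<in> {p'\<in>A. g p' = g p}"
      then have "p' \<in> A" "g p' = g p" by simp_all
      moreover have "hvec p' \<in> g p'" by (simp add: g_def vec.span_base)
      ultimately show "p' \<in> jline q p \<inter> A" by (simp add: in_jline_iff g_def)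
    qed
    then have "card {p'\<in>A. g p' = g p} \<le> card (jline q p \<inter> A)"
      using assms(1) by (intro card_mono) auto
    then show ?thesis using few [OF proj_line_jline [OF \<open>q \<noteq> p\<close>]] by (simp add: m_def)
  qed
  then obtain xs where xs: "distinct xs" "set xs = A"
    "\<And>i j. i < j \<Longrightarrow> j < length xs \<Longrightarrow> m \<le> j - i \<Longrightarrow> g (xs ! i) \<noteq> g (xs ! j)"
    using ex_spread_list [OF assms(1), of g m] by blast
  have len: "length xs \<le> d" using xs(1,2) assms(2) distinct_card by metis
  have spread: "g (xs ! i) \<noteq> g (xs ! j)"
    if ij: "i < length xs" "j < length xs" "m \<le> j - i \<or> m \<le> i - j" for i j
  proof -
    have "0 < m" using d by (simp add: m_def)
    then consider "i < j" "m \<le> j - i" | "j < i" "m \<le> i - j" using ij(3) by linarith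
    then show ?thesis using xs(3) [of i j] xs(3) [of j i] ij(1,2) by cases auto
  qed
  define \<sigma> where "\<sigma> i = (if i + m < d then i + m else i + m - d)" for i
  \<comment> \<open>A shift moves forward by \<open>m\<close> or wraps around and moves back by
    \<open>d - m\<close>. Since \<open>m\<close> is at most half of \<open>d\<close>, both distances
    are at least \<open>m\<close>.\<close>
  have m: "0 < m" "m \<le> d - m" "m < d" using d by (auto simp: m_def)
  have \<sigma>: "\<sigma> i < d" "m \<le> \<sigma> i - i \<or> m \<le> i - \<sigma> i" "\<sigma> i \<noteq> i" if "i < d" for i
    using that m by (auto simp: \<sigma>_def)
  \<comment> \<open>Positions past the end of the list contribute no point: with fewer than
    \<open>d\<close> points some linear forms have one prescribed zero or none.\<close>
  define S where "S i = (!) xs ` ({i, \<sigma> i} \<inter> {..<length xs})" for i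
  have "\<exists>l. (\<forall>p\<in>S i. cdot l (hvec p) = 0) \<and> cdot l (hvec q) \<noteq> 0" if "i < d" for i
  proof -
    have one: "hvec q \<notin> vec.span {hvec p}" if "p \<in> A" for p
      using hvec_notin_span [of q p] that assms(4) by auto
    have "hvec q \<notin> vec.span (hvec ` S i)"
    proof (cases "i < length xs \<and> \<sigma> i < length xs")
      case True
      let ?p = "xs ! i" and ?p' = "xs ! \<sigma> i"
      have A: "?p \<in> A" "?p' \<in> A" using True xs(2) by auto
      have ne: "g ?p \<noteq> g ?p'" using spread [of i "\<sigma> i"] True \<sigma>(2) [OF \<open>i < d\<close>] by blast
      \<comment> \<open>If \<open>q\<close> were collinear with the two points, both would span the
        same line with \<open>q\<close> and so have the same value of \<open>g\<close>.\<close>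
      have "hvec q \<notin> vec.span {hvec ?p, hvec ?p'}"
      proof
        assume "hvec q \<in> vec.span {hvec ?p, hvec ?p'}"
        then have q: "q \<in> jline ?p ?p'" by (simp add: in_jline_iff)
        have "?p \<noteq> ?p'" using ne by auto
        then have L: "proj_line (jline ?p ?p')" by (rule proj_line_jline)
        have qp: "q \<noteq> ?p" "q \<noteq> ?p'" using A assms(4) by auto
        have "jline q ?p = jline q ?p'"
          using proj_line_eq_jline [OF L q in_jline(1) qp(1)]
            proj_line_eq_jline [OF L q in_jline(2) qp(2)] by simp
        moreover have "?p \<in> jline q ?p" "?p' \<in> jline q ?p'" by simp_all
        ultimately have "hvec ?p \<in> g ?p'" "hvec ?p' \<in> g ?p"
          unfolding g_def by (metis in_jline_iff)+
        moreover have "hvec q \<in> g ?p" "hvec q \<in> g ?p'" by (simp_all add: g_def vec.span_base)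
        ultimately have "g ?p = g ?p'"
          unfolding g_def by (intro vec.span_eq [THEN iffD2]) auto
        then show False using ne by blast
      qed
      moreover have "hvec ` S i = {hvec ?p, hvec ?p'}" using True by (auto simp: S_def)
      ultimately show ?thesis by simp
    next
      case False
      then have "S i = {} \<or> (\<exists>p\<in>A. S i = {p})"
        by (cases "i < length xs"; cases "\<sigma> i < length xs") (auto simp: S_def simp flip: xs(2))
      then show ?thesis using one hvec(1) [of q] by auto
    qed
    then obtain l where "\<And>w. w \<in> vec.span (hvec ` S i) \<Longrightarrow> cdot l w = 0" "cdot l (hvec q) \<noteq> 0"
      using separating_functional by blast
    then show ?thesis by (blast intro: vec.span_base)
  qed
  then obtain l where l: "\<And>i p. i < d \<Longrightarrow> p \<in> S i \<Longrightarrow> cdot (l i) (hvec p) = 0"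
    "\<And>i. i < d \<Longrightarrow> cdot (l i) (hvec q) \<noteq> 0" by metis
  define F where "F z = (\<Prod>i<d. cdot (l i) z)" for z
  show ?thesis
  proof
    have "F \<in> hforms (\<Sum>i<d. 1)"
      unfolding F_def [abs_def] by (intro hforms_prod hforms_cdot) simp
    then show "F \<in> hforms d" by simp
    show "F (hvec q) \<noteq> 0" using l(2) by (simp add: F_def)
    fix p assume "p \<in> A"
    then obtain j where j: "j < length xs" "p = xs ! j" using xs(2) by (metis in_set_conv_nth)
    \<comment> \<open>The cyclic predecessor of \<open>j\<close>: the factors \<open>i\<close> and
      \<open>j\<close> are the two that vanish at \<open>p\<close>.\<close>
    define i where "i = (if m \<le> j then j - m else j + d - m)"
    have i: "i < d" "\<sigma> i = j" using j(1) len m by (auto simp: i_def \<sigma>_def)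
    have "p \<in> S j" "p \<in> S i" using j i by (auto simp: S_def)
    then show "gradient F (hvec p) = 0"
      unfolding F_def [abs_def]
      using gradient_prod_linear [of "{..<d}" i j l "hvec p"] l(1) i \<sigma>(3) [OF i(1)] j(1) len by auto
  qed
qed

subsection \<open>Base loci of the Veronese variety\<close>

text \<open>No equations are needed on the open set where the constant form 1 is nonzero, which is
  everything.\<close>

lemma smooth_locus_UNIV: "smooth_locus (UNIV :: 'n::finite proj set) = UNIV"
proof -
  have "p \<in> smooth_locus UNIV" for p :: "'n proj"
  proof -
    have "(\<lambda>_::complex ^ 'n. 1) \<in> forms" using hforms_const by (auto simp: forms_eq_Union_hforms)
    moreover have "\<not> vanishes_at (\<lambda>_. 1) p" using hvec_in_Rep by (auto simp: vanishes_at_def)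
    ultimately show ?thesis
      unfolding smooth_locus_def
      by (intro CollectI conjI UNIV_I exI [of _ "{}"] exI [of _ "\<lambda>_. 1"])
        (simp_all add: vec.independent_empty)
  qed
  then show ?thesis by blast
qed

lemma smooth_sets_UNIV: "smooth_sets r (UNIV :: 'n::finite proj set) = {A. finite A \<and> card A = r}"
  by (simp add: smooth_sets_def smooth_locus_UNIV)

lemma card_proj_line_Int_le_1:
  assumes "proj_line L" "proj_line R" "L \<noteq> R"
  shows "card (L \<inter> R \<inter> A) \<le> 1"
proof -
  have eq: "x = y" if "x \<in> L \<inter> R" "y \<in> L \<inter> R" for x y
    using that assms proj_line_unique by blast
  have "finite (L \<inter> R)"
  proof (cases "L \<inter> R = {}")
    case False
    then obtain x where "x \<in> L \<inter> R" by blast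
    then have "L \<inter> R \<subseteq> {x}" using eq by blast
    then show ?thesis using finite_subset by blast
  qed simp
  then have "finite (L \<inter> R \<inter> A)" by simp
  then have "card (L \<inter> R \<inter> A) \<le> Suc 0" using eq card_le_Suc0_iff_eq by (metis IntD1)
  then show "card (L \<inter> R \<inter> A) \<le> 1" by simp
qed

lemma two_le_card_iff:
  assumes "finite S"
  shows "2 \<le> card S \<longleftrightarrow> (\<exists>x\<in>S. \<exists>y\<in>S. x \<noteq> y)"
  using card_le_Suc0_iff_eq [OF assms] by (metis not_less_eq_eq numeral_2_eq_2)

lemma joining_lines_eq:
  assumes "finite A"
  shows "joining_lines A = {L. proj_line L \<and> 2 \<le> card (L \<inter> A)}"
  using assms by (auto simp: joining_lines_def two_le_card_iff)

lemma joining_lines_3: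
  assumes "a \<noteq> b" "a \<noteq> c" "b \<noteq> c"
  shows "joining_lines {a, b, c} = {jline a b, jline a c, jline b c}"
proof
  show "{jline a b, jline a c, jline b c} \<subseteq> joining_lines {a, b, c}"
    using assms proj_line_jline in_jline unfolding joining_lines_def by blast
  show "joining_lines {a, b, c} \<subseteq> {jline a b, jline a c, jline b c}"
    unfolding joining_lines_def using proj_line_eq_jline assms by blast
qed

section \<open>Rich lines and the base part\<close>

context veronese_exponents
begin

text \<open>The linear system of degree \<open>d\<close> forms with double points along
  \<open>A\<close>: since \<open>d\<close> is positive, Euler's relation makes them vanish on
  \<open>A\<close> as well.\<close>

definition singular_on :: "'n proj set \<Rightarrow> (complex ^ 'n \<Rightarrow> complex) set" where
  "singular_on A = {F \<in> hforms d. \<forall>p\<in>A. gradient F (hvec p) = 0}"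

text \<open>The doubled inequality expresses the threshold (d+1)/2 for both parities without
  rounding.\<close>

definition rich_lines :: "'n proj set \<Rightarrow> 'n proj set set" where
  "rich_lines A = {L. proj_line L \<and> d + 1 \<le> 2 * card (L \<inter> A)}"

lemma smooth_locus_range_veronese: "smooth_locus (range (veronese e)) = range (veronese e)"
  using smooth_locus_veronese by (simp add: veronese_variety_def)

lemma base_part_veronese:
  "base_part (veronese_variety e) (veronese e ` A) =
    veronese e ` {q. q \<notin> A \<and> (\<forall>F\<in>singular_on A. F (hvec q) = 0)}"
proof -
  have "(veronese e q \<in> veronese e ` A) = (q \<in> A)" for q
    using inj_veronese by (rule inj_image_mem_iff)
  then show ?thesis
    unfolding base_part_def veronese_variety_def smooth_locus_range_veronese
    using veronese_in_double_span_iff [of _ A]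
    by (auto simp: singular_on_def veronese_variety_def)
qed

lemma double_span_ne_UNIV:
  assumes "F \<in> singular_on A" and "F (hvec q) \<noteq> 0"
  shows "double_span (veronese_variety e) (veronese e ` A) \<noteq> UNIV"
  using assms veronese_in_double_span_iff [of q A] by (auto simp: singular_on_def)

lemma smooth_sets_veronese:
  "smooth_sets r (veronese_variety e) = (`) (veronese e) ` {A. finite A \<and> card A = r}"
proof (intro set_eqI iffI)
  fix B assume "B \<in> smooth_sets r (veronese_variety e)"
  then have B: "B \<subseteq> range (veronese e)" "finite B" "card B = r"
    by (auto simp: smooth_sets_def veronese_variety_def smooth_locus_range_veronese)
  from B(1) obtain A where A: "B = veronese e ` A" by (metis subset_imageE)
  have inj: "inj_on (veronese e) A" using inj_veronese by (rule inj_on_subset) simp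
  show "B \<in> (`) (veronese e) ` {A. finite A \<and> card A = r}"
    using A B card_image [OF inj] finite_image_iff [OF inj] by auto
next
  fix B assume "B \<in> (`) (veronese e) ` {A. finite A \<and> card A = r}"
  then obtain A where A: "B = veronese e ` A" "finite A" "card A = r" by blast
  have inj: "inj_on (veronese e) A" using inj_veronese by (rule inj_on_subset) simp
  show "B \<in> smooth_sets r (veronese_variety e)"
    using A card_image [OF inj]
    by (auto simp: smooth_sets_def veronese_variety_def smooth_locus_range_veronese)
qed

lemma singular_on_rich_line:
  assumes "finite A" "F \<in> singular_on A" "L \<in> rich_lines A" "q \<in> L"
  shows "F (hvec q) = 0"
  using hforms_vanish_on_line [of F d A L q] assms d by (auto simp: singular_on_def rich_lines_def)

lemma base_part_superset:
  assumes "finite A"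
  shows "veronese e ` (\<Union>(rich_lines A) - A) \<subseteq> base_part (veronese_variety e) (veronese e ` A)"
  unfolding base_part_veronese using singular_on_rich_line [OF assms] by blast

lemma base_part_eq:
  assumes "finite A" and "card A \<le> d"
  shows "base_part (veronese_variety e) (veronese e ` A) = veronese e ` (\<Union>(rich_lines A) - A)"
proof
  show "base_part (veronese_variety e) (veronese e ` A) \<subseteq> veronese e ` (\<Union>(rich_lines A) - A)"
    unfolding base_part_veronese
  proof (intro image_mono subsetI)
    fix q assume "q \<in> {q. q \<notin> A \<and> (\<forall>F\<in>singular_on A. F (hvec q) = 0)}"
    then have q: "q \<notin> A" "\<And>F. F \<in> singular_on A \<Longrightarrow> F (hvec q) = 0" by blast+
    have "\<exists>L. proj_line L \<and> q \<in> L \<and> \<not> 2 * card (L \<inter> A) \<le> d"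
    proof (rule ccontr)
      assume "\<not> ?thesis"
      then have "2 * card (L \<inter> A) \<le> d" if "proj_line L" "q \<in> L" for L using that by blast
      then obtain F where "F \<in> hforms d" "\<And>p. p \<in> A \<Longrightarrow> gradient F (hvec p) = 0" "F (hvec q) \<noteq> 0"
        using ex_singular_form_nonvanishing [OF assms d q(1)] by metis
      then show False using q(2) by (auto simp: singular_on_def)
    qed
    then show "q \<in> \<Union>(rich_lines A) - A" using q(1) by (auto simp: rich_lines_def not_le)
  qed
  show "veronese e ` (\<Union>(rich_lines A) - A) \<subseteq> base_part (veronese_variety e) (veronese e ` A)"
    using assms(1) by (rule base_part_superset)
qed

text \<open>In dimension at least two a line lies in a hyperplane. The d-th power of its equation,
  with d >= 2, is singular along the line and nonzero off the hyperplane.\<close>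

lemma double_span_ne_UNIV_collinear:
  assumes "proj_line L" and "A \<subseteq> L" and "3 \<le> CARD('n)"
  shows "double_span (veronese_variety e) (veronese e ` A) \<noteq> UNIV"
proof -
  obtain W where W: "vec.subspace W" "vec.dim W = 2" "L = linear_locus W"
    using assms(1) by (auto simp: proj_line_def)
  have "W \<noteq> UNIV"
  proof
    assume "W = UNIV"
    then have "vec.dim W = CARD('n)" by (simp only: vec_dim_card)
    then show False using W(2) assms(3) by simp
  qed
  then obtain x where x: "x \<notin> W" by blast
  have sp: "vec.span W = W" using W(1) by (simp add: vec.span_eq_iff)
  have "x \<noteq> 0" using x W(1) vec.subspace_0 by blast
  then obtain q where q: "Rep_proj q = vec.span {x}" by (rule ex_proj)
  have "hvec q \<notin> W"
  proof
    assume "hvec q \<in> W"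
    then have "Rep_proj q \<subseteq> W" using W(1) by (simp add: hvec(2) vec.span_minimal)
    moreover have "x \<in> Rep_proj q" by (simp add: q vec.span_base)
    ultimately show False using x by blast
  qed
  then obtain l where l: "\<And>w. w \<in> W \<Longrightarrow> cdot l w = 0" "cdot l (hvec q) \<noteq> 0"
    using separating_functional [of "hvec q" W] sp by metis
  define F where "F z = (\<Prod>i<d. cdot l z)" for z
  have "F \<in> hforms (\<Sum>i<d. 1)"
    unfolding F_def [abs_def] by (intro hforms_prod hforms_cdot) simp
  moreover have "gradient F (hvec p) = 0" if "p \<in> A" for p
  proof -
    have "cdot l (hvec p) = 0" using that assms(2) W l(1) in_linear_locus_iff by blast
    then show ?thesis unfolding F_def [abs_def]
      using gradient_prod_linear [of "{..<d}" 0 1 "\<lambda>_. l" "hvec p"] d by simp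
  qed
  ultimately have "F \<in> singular_on A" by (simp add: singular_on_def)
  moreover have "F (hvec q) \<noteq> 0" using l(2) by (simp add: F_def)
  ultimately show ?thesis by (rule double_span_ne_UNIV)
qed

lemma base_locus_veronese_iff:
  "veronese e ` A \<in> base_locus r (veronese_variety e) \<longleftrightarrow> finite A \<and> card A = r \<and>
    double_span (veronese_variety e) (veronese e ` A) \<noteq> UNIV \<and>
    base_part (veronese_variety e) (veronese e ` A) \<noteq> {}"
proof -
  have inj: "inj_on (veronese e) A" using inj_veronese by (rule inj_on_subset) simp
  have "veronese e ` A \<in> smooth_sets r (veronese_variety e) \<longleftrightarrow> finite A \<and> card A = r"
    using card_image [OF inj] finite_image_iff [OF inj]
    by (auto simp: smooth_sets_def veronese_variety_def smooth_locus_range_veronese)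
  then show ?thesis by (auto simp: base_locus_def)
qed

lemma rich_line_base_part_nonempty:
  assumes "finite A" and "L \<in> rich_lines A"
  shows "base_part (veronese_variety e) (veronese e ` A) \<noteq> {}"
proof -
  have "infinite (L - A)" using infinite_proj_line assms by (auto simp: rich_lines_def)
  then obtain q where "q \<in> L - A" by (metis ex_in_conv finite.emptyI)
  then show ?thesis using base_part_superset [OF assms(1)] assms(2) by blast
qed

lemma ex_proj_pair: "3 \<le> CARD('n) \<Longrightarrow> \<exists>p q :: 'n proj. p \<noteq> q"
proof -
  assume "3 \<le> CARD('n)"
  then have "2 \<le> card (UNIV :: 'n set)" by simp
  then obtain i j :: 'n where ij: "i \<noteq> j" by (auto simp: two_le_card_iff)
  have nz: "axis k 1 \<noteq> (0 :: complex ^ 'n)" for k by (simp add: axis_eq_0_iff)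
  obtain p where p: "Rep_proj p = vec.span {axis i 1 :: complex ^ 'n}" using nz by (rule ex_proj)
  obtain q where q: "Rep_proj q = vec.span {axis j 1 :: complex ^ 'n}" using nz by (rule ex_proj)
  have "p \<noteq> q"
  proof
    assume "p = q"
    then have "axis i 1 \<in> vec.span {axis j 1 :: complex ^ 'n}"
      using p q by (metis insertI1 vec.span_base)
    then obtain c where "axis i 1 = c *s (axis j 1 :: complex ^ 'n)" by (auto simp: vec.span_singleton)
    then have "axis i 1 $ i = (c *s (axis j 1 :: complex ^ 'n)) $ i" by simp
    then show False using ij by (simp add: axis_def)
  qed
  then show ?thesis by blast
qed

text \<open>If 2r <= d, then \<open>base_part_eq\<close> applies and no line can be rich.
  Conversely, r points on one line make that line rich, and their double span is not everything by
  \<open>double_span_ne_UNIV_collinear\<close>.\<close>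

lemma base_locus_nonempty_iff:
  assumes "3 \<le> CARD('n)" and "1 \<le> r"
  shows "base_locus r (veronese_variety e) \<noteq> {} \<longleftrightarrow> d + 1 \<le> 2 * r"
proof
  assume "base_locus r (veronese_variety e) \<noteq> {}"
  then obtain B where B: "B \<in> base_locus r (veronese_variety e)" by blast
  then have "B \<in> smooth_sets r (veronese_variety e)" by (simp add: base_locus_def)
  then obtain A where A: "B = veronese e ` A" by (auto simp: smooth_sets_veronese)
  have A': "finite A" "card A = r" and ne: "base_part (veronese_variety e) (veronese e ` A) \<noteq> {}"
    using B unfolding A base_locus_veronese_iff by blast+
  show "d + 1 \<le> 2 * r"
  proof (rule ccontr)
    assume "\<not> d + 1 \<le> 2 * r"
    then have "card A \<le> d" using A' by simp
    then have "rich_lines A \<noteq> {}" using base_part_eq [OF A'(1)] ne by auto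
    then obtain L where L: "d + 1 \<le> 2 * card (L \<inter> A)" by (auto simp: rich_lines_def)
    have "card (L \<inter> A) \<le> card A" using A'(1) by (intro card_mono) auto
    then show False using L A'(2) \<open>\<not> d + 1 \<le> 2 * r\<close> by linarith
  qed
next
  assume r: "d + 1 \<le> 2 * r"
  obtain p q :: "'n proj" where "p \<noteq> q" using ex_proj_pair [OF assms(1)] by blast
  then have L: "proj_line (jline p q)" by (rule proj_line_jline)
  obtain A where A: "A \<subseteq> jline p q" "finite A" "card A = r"
    using infinite_arbitrarily_large [OF infinite_proj_line [OF L]] by blast
  have "jline p q \<inter> A = A" using A(1) by blast
  then have "jline p q \<in> rich_lines A" using L r A(3) by (simp add: rich_lines_def)
  then have "veronese e ` A \<in> base_locus r (veronese_variety e)"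
    unfolding base_locus_veronese_iff
    using rich_line_base_part_nonempty [OF A(2)] double_span_ne_UNIV_collinear [OF L A(1) assms(1)] A
    by blast
  then show "base_locus r (veronese_variety e) \<noteq> {}" by blast
qed

section \<open>How many rich lines there can be\<close>

lemma two_rich_lines:
  assumes "finite A" "card A \<le> d" "L \<in> rich_lines A" "R \<in> rich_lines A" "L \<noteq> R"
  shows "card A = d" and "odd d" and "card (L \<inter> A) = (d + 1) div 2" and "card (R \<inter> A) = (d + 1) div 2"
    and "A \<subseteq> L \<union> R" and "\<exists>p\<in>A. L \<inter> R = {p}"
proof -
  have lines: "proj_line L" "proj_line R" and k: "d + 1 \<le> 2 * card (L \<inter> A)" "d + 1 \<le> 2 * card (R \<inter> A)"
    using assms by (auto simp: rich_lines_def)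
  have sum: "card (L \<inter> A) + card (R \<inter> A) = card ((L \<union> R) \<inter> A) + card (L \<inter> R \<inter> A)"
    using card_Un_Int [of "L \<inter> A" "R \<inter> A"] assms(1)
    by (simp add: Int_Un_distrib2 Int_assoc Int_left_commute)
  have le: "card ((L \<union> R) \<inter> A) \<le> card A" using assms(1) by (intro card_mono) auto
  have le1: "card (L \<inter> R \<inter> A) \<le> 1" using card_proj_line_Int_le_1 lines assms(5) by blast
  \<comment> \<open>Inclusion-exclusion squeezes: d + 1 <= |L \<inter> A| + |R \<inter> A| <= |A| +
    1 <= d + 1, so every estimate is an equality, including the common point in
    \<open>A\<close>.\<close>
  show d': "card A = d" using sum le le1 k assms(2) by linarith
  have eq: "card (L \<inter> A) + card (R \<inter> A) = d + 1" and e1: "card (L \<inter> R \<inter> A) = 1"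
    and eA: "card ((L \<union> R) \<inter> A) = card A" using sum le le1 k assms(2) by linarith+
  have LR: "2 * card (L \<inter> A) = d + 1" "2 * card (R \<inter> A) = d + 1" using eq k by linarith+
  then show "card (L \<inter> A) = (d + 1) div 2" "card (R \<inter> A) = (d + 1) div 2" by linarith+
  show "odd d" using LR by presburger
  have "(L \<union> R) \<inter> A = A" using eA assms(1) by (intro card_subset_eq) auto
  then show "A \<subseteq> L \<union> R" by blast
  obtain p where p: "L \<inter> R \<inter> A = {p}" using e1 card_1_singletonE by blast
  then have "L \<inter> R \<subseteq> {p}" using proj_line_unique lines assms(5) by blast
  then show "\<exists>p\<in>A. L \<inter> R = {p}" using p by blast
qed

text \<open>Two rich lines cover \<open>A\<close>, and a third line meets each of them at most once.
  Its at most two points of \<open>A\<close> fall short of the threshold, which is at least three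
  for d >= 5.\<close>

lemma third_rich_line:
  assumes "finite A" "card A \<le> d" "5 \<le> d" "L \<in> rich_lines A" "R \<in> rich_lines A" "L \<noteq> R"
  shows "rich_lines A = {L, R}"
proof -
  have "T = L \<or> T = R" if T: "T \<in> rich_lines A" for T
  proof (rule ccontr)
    assume ne: "\<not> (T = L \<or> T = R)"
    have l: "proj_line T" "proj_line L" "proj_line R" using assms T by (auto simp: rich_lines_def)
    have "T \<inter> A \<subseteq> (T \<inter> L \<inter> A) \<union> (T \<inter> R \<inter> A)" using two_rich_lines(5) [OF assms(1,2,4,5,6)] by blast
    then have "card (T \<inter> A) \<le> card ((T \<inter> L \<inter> A) \<union> (T \<inter> R \<inter> A))"
      using assms(1) by (intro card_mono) auto
    also have "\<dots> \<le> card (T \<inter> L \<inter> A) + card (T \<inter> R \<inter> A)" by (rule card_Un_le)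
    also have "\<dots> \<le> 1 + 1"
      using ne l by (intro add_mono card_proj_line_Int_le_1) auto
    finally have "card (T \<inter> A) \<le> 2" by simp
    then show False using T assms(3) by (simp add: rich_lines_def)
  qed
  then show ?thesis using assms by blast
qed

section \<open>Three points and cubics\<close>

lemma noncollinear_triple_double_span_ne_UNIV:
  assumes "d = 3" and "a \<noteq> b" "a \<noteq> c" "b \<noteq> c" and nc: "\<And>L. proj_line L \<Longrightarrow> \<not> {a, b, c} \<subseteq> L"
  shows "double_span (veronese_variety e) (veronese e ` {a, b, c}) \<noteq> UNIV"
proof -
  \<comment> \<open>The unit point of the triangle a, b, c. It lies on no side, since subtracting
    two of the summands would put the third vertex on that side. Lines through it thus contain at
    most one vertex, as \<open>ex_singular_form_nonvanishing\<close> requires for d = 3.\<close>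
  let ?v = "hvec a + hvec b + hvec c"
  have off: "hvec x + hvec y + hvec z \<notin> vec.span {hvec x, hvec y}"
    if "x \<noteq> y" "{x, y, z} = {a, b, c}" for x y z
  proof
    assume "hvec x + hvec y + hvec z \<in> vec.span {hvec x, hvec y}"
    moreover have "hvec x + hvec y \<in> vec.span {hvec x, hvec y}"
      by (intro vec.span_add) (simp_all add: vec.span_base)
    ultimately have "(hvec x + hvec y + hvec z) - (hvec x + hvec y) \<in> vec.span {hvec x, hvec y}"
      by (rule vec.span_diff)
    moreover have "(hvec x + hvec y + hvec z) - (hvec x + hvec y) = hvec z" by simp
    ultimately have "z \<in> jline x y" by (simp only: in_jline_iff)
    then have "{x, y, z} \<subseteq> jline x y" by simp
    then show False using nc [OF proj_line_jline [OF that(1)]] that(2) by simp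
  qed
  have o: "?v \<notin> vec.span {hvec a, hvec b}" "?v \<notin> vec.span {hvec a, hvec c}" "?v \<notin> vec.span {hvec b, hvec c}"
    using off [of a b c] off [of a c b] off [of b c a] assms(2-4) by (auto simp: algebra_simps insert_commute)
  have "?v \<noteq> 0" using o(1) vec.span_zero by metis
  then obtain q where q: "Rep_proj q = vec.span {?v}" by (rule ex_proj)
  have qj: "q \<notin> jline x y" if "?v \<notin> vec.span {hvec x, hvec y}" for x y
  proof
    assume "q \<in> jline x y"
    then have "vec.span {?v} \<subseteq> vec.span {hvec x, hvec y}" by (simp add: jline_def linear_locus_def q)
    then show False using that by (auto intro: vec.span_base)
  qed
  then have notin: "q \<notin> jline a b" "q \<notin> jline a c" "q \<notin> jline b c" using o by blast+
  then have qA: "q \<notin> {a, b, c}" by auto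
  have few: "2 * card (L \<inter> {a, b, c}) \<le> d" if "proj_line L" "q \<in> L" for L
  proof (rule ccontr)
    assume "\<not> 2 * card (L \<inter> {a, b, c}) \<le> d"
    then have "L \<in> joining_lines {a, b, c}" using that assms(1) by (simp add: joining_lines_eq)
    then show False using joining_lines_3 [OF assms(2-4)] notin that(2) by auto
  qed
  have "card {a, b, c} \<le> d" using assms by simp
  then obtain F where "F \<in> hforms d" "\<And>p. p \<in> {a, b, c} \<Longrightarrow> gradient F (hvec p) = 0" "F (hvec q) \<noteq> 0"
    using ex_singular_form_nonvanishing [OF _ _ d qA few] by blast
  then show ?thesis by (intro double_span_ne_UNIV [of F _ q]) (auto simp: singular_on_def)
qed

text \<open>For \<open>d = 3\<close> the threshold is two points, so any two points of
  \<open>A\<close> already span a rich line.\<close>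

lemma rich_lines_3:
  assumes "d = 3" and "finite A"
  shows "rich_lines A = joining_lines A"
  unfolding rich_lines_def joining_lines_eq [OF assms(2)] using assms(1) by auto

lemma base_locus_3:
  assumes "d = 3" and "3 \<le> CARD('n)"
  shows "base_locus 3 (veronese_variety e) = smooth_sets 3 (veronese_variety e)"
proof
  show "base_locus 3 (veronese_variety e) \<subseteq> smooth_sets 3 (veronese_variety e)"
    by (auto simp: base_locus_def)
  show "smooth_sets 3 (veronese_variety e) \<subseteq> base_locus 3 (veronese_variety e)"
  proof
    fix B assume "B \<in> smooth_sets 3 (veronese_variety e)"
    then obtain A where A: "B = veronese e ` A" "finite A" "card A = 3" by (auto simp: smooth_sets_veronese)
    then obtain a b c where abc: "A = {a, b, c}" "a \<noteq> b" "a \<noteq> c" "b \<noteq> c" by (auto simp: card_3_iff)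
    have "jline a b \<in> rich_lines A"
      using rich_lines_3 [OF assms(1) A(2)] joining_lines_3 [OF abc(2-4)] by (simp add: abc(1))
    then have "base_part (veronese_variety e) (veronese e ` A) \<noteq> {}"
      by (rule rich_line_base_part_nonempty [OF A(2)])
    moreover have "double_span (veronese_variety e) (veronese e ` A) \<noteq> UNIV"
      using noncollinear_triple_double_span_ne_UNIV [OF assms(1) abc(2-4)]
        double_span_ne_UNIV_collinear [OF _ _ assms(2)] abc(1) by blast
    ultimately show "B \<in> base_locus 3 (veronese_variety e)"
      using A by (simp add: base_locus_veronese_iff)
  qed
qed

lemma base_part_noncollinear_triple:
  assumes "d = 3" and "finite A" "card A = 3" and nc: "\<not> (\<exists>L. proj_line L \<and> A \<subseteq> L)"
  shows "card (joining_lines A) = 3"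
    and "base_part (veronese_variety e) (veronese e ` A) \<union> veronese e ` A = veronese e ` (\<Union>(joining_lines A))"
proof -
  obtain a b c where abc: "A = {a, b, c}" "a \<noteq> b" "a \<noteq> c" "b \<noteq> c"
    using assms(3) by (auto simp: card_3_iff)
  have J: "joining_lines A = {jline a b, jline a c, jline b c}"
    unfolding abc(1) using abc(2-4) by (rule joining_lines_3)
  have off: "z \<notin> jline x y" if "x \<noteq> y" "A \<subseteq> {x, y, z}" for x y z
  proof
    assume "z \<in> jline x y"
    then have "{x, y, z} \<subseteq> jline x y" by simp
    then have "A \<subseteq> jline x y" using that(2) by (rule order_trans [rotated])
    then show False using nc proj_line_jline [OF that(1)] by blast
  qed
  have "c \<notin> jline a b" "b \<notin> jline a c" "a \<notin> jline b c"
    using off [of a b c] off [of a c b] off [of b c a] abc by auto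
  then have "jline a b \<noteq> jline a c" "jline a b \<noteq> jline b c" "jline a c \<noteq> jline b c"
    by (metis in_jline)+
  then show "card (joining_lines A) = 3" by (simp add: J)
  have "A \<subseteq> \<Union>(joining_lines A)" unfolding J using abc(1) by auto
  moreover have "base_part (veronese_variety e) (veronese e ` A) = veronese e ` (\<Union>(joining_lines A) - A)"
    using base_part_eq [OF assms(2)] assms(1,3) rich_lines_3 [OF assms(1,2)] by simp
  ultimately show "base_part (veronese_variety e) (veronese e ` A) \<union> veronese e ` A
      = veronese e ` (\<Union>(joining_lines A))" by (simp add: Un_absorb2 flip: image_Un)
qed

lemma base_part_collinear_triple:
  assumes "d = 3" and "finite A" "card A = 3" and L: "proj_line L" "A \<subseteq> L"
  shows "base_part (veronese_variety e) (veronese e ` A) = veronese e ` (L - A)"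
proof -
  have LA: "L \<inter> A = A" using L by blast
  have "joining_lines A = {L}"
  proof
    show "joining_lines A \<subseteq> {L}"
      unfolding joining_lines_def using proj_line_unique L by blast
    show "{L} \<subseteq> joining_lines A"
      using L assms LA by (simp add: joining_lines_eq)
  qed
  then show ?thesis using base_part_eq [OF assms(2)] assms(1,3) rich_lines_3 [OF assms(1,2)] by simp
qed

end

section \<open>Case distinction on the number of rich lines\<close>

theorem theorem3p5:
  fixes n d r :: nat
    and e :: "'m::finite \<Rightarrow> 'n::finite \<Rightarrow> nat"
  assumes "n \<ge> 2" and "d \<ge> 2" and "r \<ge> 1"
    and "CARD('n) = n + 1"
    and "bij_betw e UNIV (exponents d)"
  shows
    "(base_locus r (veronese_variety e) \<noteq> {} \<longleftrightarrow> 2 * r \<ge> d + 1) \<and>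
     (nat \<lceil>(real d + 1) / 2\<rceil> \<le> r \<and> r \<le> d \<longrightarrow>
       (\<forall>A \<in> smooth_sets r (UNIV :: 'n proj set). veronese e ` A \<in> base_locus r (veronese_variety e) \<longrightarrow>
          (r = d \<and> d \<ge> 5 \<and> odd d \<longrightarrow>
             (\<exists>L. proj_line L \<and> card (L \<inter> A) \<ge> (d + 1) div 2 \<and>
                  base_part (veronese_variety e) (veronese e ` A) = veronese e ` (L - A)) \<or>
             (\<exists>L R. proj_line L \<and> proj_line R \<and> L \<noteq> R \<and> (\<exists>p \<in> A. L \<inter> R = {p}) \<and>
                  card (L \<inter> A) = (d + 1) div 2 \<and> card (R \<inter> A) = (d + 1) div 2 \<and>
                  base_part (veronese_variety e) (veronese e ` A) = veronese e ` ((L \<union> R) - A))) \<and>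
          (r < d \<or> (r = d \<and> even d) \<longrightarrow>
             (\<exists>L. proj_line L \<and> card (L \<inter> A) \<ge> nat \<lceil>(real d + 1) / 2\<rceil> \<and>
                  base_part (veronese_variety e) (veronese e ` A) = veronese e ` (L - A)))) \<and>
       (r = 3 \<and> d = 3 \<longrightarrow>
          base_locus 3 (veronese_variety e) = smooth_sets 3 (veronese_variety e) \<and>
          (\<forall>A \<in> smooth_sets 3 (UNIV :: 'n proj set).
             (\<not> (\<exists>L. proj_line L \<and> A \<subseteq> L) \<longrightarrow>
                card (joining_lines A) = 3 \<and>
                base_part (veronese_variety e) (veronese e ` A) \<union> veronese e ` A = veronese e ` (\<Union>(joining_lines A))) \<and>
             ((\<exists>L. proj_line L \<and> A \<subseteq> L) \<longrightarrow>
                (\<exists>L. proj_line L \<and> A \<subseteq> L \<and>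
                  base_part (veronese_variety e) (veronese e ` A) = veronese e ` (L - A))))))"
proof -
  interpret veronese_exponents e d using assms(2,5) by unfold_locales
  have dim: "3 \<le> CARD('n)" using assms(1,4) by simp
  \<comment> \<open>Turns the rounded thresholds, both for \<open>r\<close> and for the number of
    points on \<open>L\<close>, into the inequality that defines rich lines.\<close>
  have ceil: "nat \<lceil>(real d + 1) / 2\<rceil> \<le> k \<longleftrightarrow> d + 1 \<le> 2 * k" for k
    by (simp add: nat_le_iff ceiling_le_iff) linarith
  let ?b = "\<lambda>A. base_part (veronese_variety e) (veronese e ` A)"
  have one: "\<exists>L. proj_line L \<and> d + 1 \<le> 2 * card (L \<inter> A) \<and> ?b A = veronese e ` (L - A)"
    if A: "finite A" "card A \<le> d" "?b A \<noteq> {}"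
      and uniq: "\<And>L R. L \<in> rich_lines A \<Longrightarrow> R \<in> rich_lines A \<Longrightarrow> L = R" for A
  proof -
    have "rich_lines A \<noteq> {}" using A(3) base_part_eq [OF A(1,2)] by auto
    then obtain L where L: "L \<in> rich_lines A" by blast
    then have "rich_lines A = {L}" using uniq by blast
    then have "?b A = veronese e ` (L - A)" using base_part_eq [OF A(1,2)] by simp
    then show ?thesis using L by (auto simp: rich_lines_def)
  qed
  have p1: "(\<exists>L. proj_line L \<and> card (L \<inter> A) \<ge> (d + 1) div 2 \<and> ?b A = veronese e ` (L - A)) \<or>
     (\<exists>L R. proj_line L \<and> proj_line R \<and> L \<noteq> R \<and> (\<exists>p \<in> A. L \<inter> R = {p}) \<and>
        card (L \<inter> A) = (d + 1) div 2 \<and> card (R \<inter> A) = (d + 1) div 2 \<and>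
        ?b A = veronese e ` ((L \<union> R) - A))"
    if A: "finite A" "card A \<le> d" "?b A \<noteq> {}" and d5: "5 \<le> d" for A
  proof (cases "\<forall>L\<in>rich_lines A. \<forall>R\<in>rich_lines A. L = R")
    case True
    then obtain L where "proj_line L" "d + 1 \<le> 2 * card (L \<inter> A)" "?b A = veronese e ` (L - A)"
      using one [OF A] by blast
    then show ?thesis by (intro disjI1 exI [of _ L]) simp
  next
    case False
    then obtain L R where LR: "L \<in> rich_lines A" "R \<in> rich_lines A" "L \<noteq> R" by blast
    have "?b A = veronese e ` ((L \<union> R) - A)"
      using base_part_eq [OF A(1,2)] third_rich_line [OF A(1,2) d5 LR] by simp
    then show ?thesis
      using two_rich_lines [OF A(1,2) LR] LR
      by (intro disjI2 exI [of _ L] exI [of _ R]) (simp add: rich_lines_def)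
  qed
  \<comment> \<open>The rich line is unique here: by \<open>two_rich_lines\<close> a second one
    would force \<open>card A = d\<close> and \<open>d\<close> odd.\<close>
  have p2: "\<exists>L. proj_line L \<and> d + 1 \<le> 2 * card (L \<inter> A) \<and> ?b A = veronese e ` (L - A)"
    if A: "finite A" "card A \<le> d" "?b A \<noteq> {}" and "card A < d \<or> even d" for A
    using one [OF A] two_rich_lines(1,2) [OF A(1,2)] that(4) by (metis less_irrefl)
  show ?thesis
    unfolding ceil smooth_sets_UNIV base_locus_veronese_iff
  proof (rule conjI, goal_cases)
    case 1
    show "base_locus r (veronese_variety e) \<noteq> {} \<longleftrightarrow> 2 * r \<ge> d + 1"
      using base_locus_nonempty_iff [OF dim assms(3)] by simp
  next
    case 2
    have triple: "r = 3 \<and> d = 3 \<longrightarrow> base_locus 3 (veronese_variety e) = smooth_sets 3 (veronese_variety e) \<and>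
      (\<forall>A\<in>{A. finite A \<and> card A = 3}.
        (\<not> (\<exists>L. proj_line L \<and> A \<subseteq> L) \<longrightarrow> card (joining_lines A) = 3 \<and>
          ?b A \<union> veronese e ` A = veronese e ` (\<Union>(joining_lines A))) \<and>
        ((\<exists>L. proj_line L \<and> A \<subseteq> L) \<longrightarrow>
          (\<exists>L. proj_line L \<and> A \<subseteq> L \<and> ?b A = veronese e ` (L - A))))"
    proof (intro impI conjI ballI)
      assume "r = 3 \<and> d = 3"
      then have d3: "d = 3" by simp
      show "base_locus 3 (veronese_variety e) = smooth_sets 3 (veronese_variety e)"
        by (rule base_locus_3 [OF d3 dim])
      fix A :: "'n proj set" assume "A \<in> {A. finite A \<and> card A = 3}"
      then have A: "finite A" "card A = 3" by simp_all
      show "card (joining_lines A) = 3" "?b A \<union> veronese e ` A = veronese e ` (\<Union>(joining_lines A))"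
        if "\<not> (\<exists>L. proj_line L \<and> A \<subseteq> L)"
        using base_part_noncollinear_triple [OF d3 A that] by blast+
      assume "\<exists>L. proj_line L \<and> A \<subseteq> L"
      then show "\<exists>L. proj_line L \<and> A \<subseteq> L \<and> ?b A = veronese e ` (L - A)"
        using base_part_collinear_triple [OF d3 A] by blast
    qed
    show ?case
    proof (rule impI, rule conjI [OF _ triple], intro ballI impI, goal_cases)
      case (1 A)
      then have A: "finite A" "card A \<le> d" "?b A \<noteq> {}" and r: "card A = r" by simp_all
      show ?case
      proof ((rule conjI; rule impI), goal_cases)
        case 1
        then have "5 \<le> d" by simp
        then show ?case by (rule p1 [OF A])
      next
        case 2
        then have "card A < d \<or> even d" using r by auto
        then show ?case by (rule p2 [OF A])
      qed
    qed
  qed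
qed

end
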